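(* If $G$ is a two-step nilpotent torsion group, $\phi\in\operatorname{End}(G)$ and $H$ is a $\phi$-invariant normal subgroup of $G$, then $\operatorname{AT}(G,\phi,H)$ holds, i.e. $h(\phi)=h(\phi\upharpoonright_H)+h(\bar\phi)$, where $\bar\phi\in\operatorname{End}(G/H)$ is the endomorphism induced by $\phi$.
   Context: Two-step nilpotent means nilpotent of class $2$. A group is torsion if each of its elements has finite order. A subgroup $H$ of $G$ is $\phi$-invariant if $\phi(H)\subseteq H$; $\phi\upharpoonright_H\in\operatorname{End}(H)$ denotes the restriction. Algebraic entropy: let $G$ be a (not necessarily abelian) group and $\phi\in\operatorname{End}(G)$. For a nonempty finite subset $X$ of $G$ and a positive integer $n$, the $n$-th $\phi$-trajectory of $X$ is $T_n(\phi,X)=X\cdot\phi(X)\cdots\phi^{n-1}(X)$ (product of subsets). Put $H(\phi,X)=\lim_{n\to\infty}\frac{\log|T_n(\phi,X)|}{n}$ (the limit exists), and $h(\phi)=\sup\{H(\phi,X): X \text{ a nonempty finite subset of } G\}\in[0,\infty]$. *)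

theory Defs
  imports Complex_Main "HOL-Library.Extended_Real" "HOL-Algebra.Coset" "HOL-Algebra.Generated_Groups"
begin

definition torsion_group :: "('a, 'b) monoid_scheme \<Rightarrow> bool" where
  "torsion_group G \<longleftrightarrow>
     group G \<and> (\<forall>x\<in>carrier G. \<exists>n::nat. n > 0 \<and> x [^]\<^bsub>G\<^esub> n = \<one>\<^bsub>G\<^esub>)"

definition commutator_subgroup ::
  "('a, 'b) monoid_scheme \<Rightarrow> 'a set \<Rightarrow> 'a set \<Rightarrow> 'a set" where
  "commutator_subgroup G A B =
     generate G {a \<otimes>\<^bsub>G\<^esub> b \<otimes>\<^bsub>G\<^esub> inv\<^bsub>G\<^esub> a \<otimes>\<^bsub>G\<^esub> inv\<^bsub>G\<^esub> b | a b. a \<in> A \<and> b \<in> B}"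

text \<open>Indexed from 0, so that \<open>lower_central_series G c\<close> is the term usually
  written $\gamma_{c+1}(G)$.\<close>

primrec lower_central_series :: "('a, 'b) monoid_scheme \<Rightarrow> nat \<Rightarrow> 'a set" where
  "lower_central_series G 0 = carrier G"
| "lower_central_series G (Suc n) = commutator_subgroup G (lower_central_series G n) (carrier G)"

text \<open>The class is exact: a group of class 2 is not abelian.\<close>

definition nilpotent_of_class :: "('a, 'b) monoid_scheme \<Rightarrow> nat \<Rightarrow> bool" where
  "nilpotent_of_class G c \<longleftrightarrow>
     group G \<and> lower_central_series G c = {\<one>\<^bsub>G\<^esub>} \<and>
     (\<forall>d<c. lower_central_series G d \<noteq> {\<one>\<^bsub>G\<^esub>})"

primrec trajectory :: "('a, 'b) monoid_scheme \<Rightarrow> ('a \<Rightarrow> 'a) \<Rightarrow> 'a set \<Rightarrow> nat \<Rightarrow> 'a set" where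
  "trajectory G \<phi> X 0 = {\<one>\<^bsub>G\<^esub>}"
| "trajectory G \<phi> X (Suc n) = trajectory G \<phi> X n <#>\<^bsub>G\<^esub> (\<phi> ^^ n) ` X"

text \<open>The limit exists whenever \<open>\<phi>\<close> is an endomorphism of the group \<open>G\<close> and \<open>X\<close> is a nonempty
  finite subset of the carrier: the sequence of logarithms is subadditive (Fekete).\<close>

definition entropy_wrt :: "('a, 'b) monoid_scheme \<Rightarrow> ('a \<Rightarrow> 'a) \<Rightarrow> 'a set \<Rightarrow> real" where
  "entropy_wrt G \<phi> X = lim (\<lambda>n. ln (real (card (trajectory G \<phi> X n))) / real n)"

definition algebraic_entropy :: "('a, 'b) monoid_scheme \<Rightarrow> ('a \<Rightarrow> 'a) \<Rightarrow> ereal" where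
  "algebraic_entropy G \<phi> =
     (SUP X \<in> {X. finite X \<and> X \<noteq> {} \<and> X \<subseteq> carrier G}. ereal (entropy_wrt G \<phi> X))"

text \<open>For an invariant normal subgroup the union below is over equal cosets, see
  \<open>induced_endo_rcos\<close>.\<close>

definition induced_endo ::
  "('a, 'b) monoid_scheme \<Rightarrow> 'a set \<Rightarrow> ('a \<Rightarrow> 'a) \<Rightarrow> 'a set \<Rightarrow> 'a set" where
  "induced_endo G H \<phi> C = (\<Union>x\<in>C. H #>\<^bsub>G\<^esub> \<phi> x)"

lemma induced_endo_rcos:
  assumes "H \<lhd> G" "\<phi> \<in> hom G G" "\<phi> ` H \<subseteq> H" "x \<in> carrier G"
  shows "induced_endo G H \<phi> (H #>\<^bsub>G\<^esub> x) = H #>\<^bsub>G\<^esub> \<phi> x"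
proof -
  interpret normal H G by fact
  have "H #>\<^bsub>G\<^esub> \<phi> y = H #>\<^bsub>G\<^esub> \<phi> x" if y: "y \<in> H #>\<^bsub>G\<^esub> x" for y
  proof -
    obtain h where h: "h \<in> H" "y = h \<otimes>\<^bsub>G\<^esub> x" using y by (auto simp: r_coset_def)
    have "\<phi> y = \<phi> h \<otimes>\<^bsub>G\<^esub> \<phi> x" using h assms by (simp add: hom_mult)
    moreover have "\<phi> h \<in> H" "\<phi> x \<in> carrier G" using h assms by (auto simp: hom_def)
    ultimately have "\<phi> y \<in> H #>\<^bsub>G\<^esub> \<phi> x" by (auto simp: r_coset_def)
    then show ?thesis
      using repr_independence[OF _ \<open>\<phi> x \<in> carrier G\<close> is_subgroup] by simp
  qed
  moreover have "x \<in> H #>\<^bsub>G\<^esub> x" using assms(4) rcos_self is_subgroup by blast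
  ultimately show ?thesis unfolding induced_endo_def by blast
qed

lemma induced_endo_hom:
  assumes "H \<lhd> G" "\<phi> \<in> hom G G" "\<phi> ` H \<subseteq> H"
  shows "induced_endo G H \<phi> \<in> hom (G Mod H) (G Mod H)"
proof -
  interpret normal H G by fact
  have c: "\<phi> x \<in> carrier G" if "x \<in> carrier G" for x using that assms by (auto simp: hom_def)
  show ?thesis
    by (rule homI)
      (auto simp: FactGroup_def RCOSETS_def rcos_sum induced_endo_rcos[OF assms] c hom_mult[OF assms(2)])
qed

end

theory Submission
  imports Defs "HOL-Algebra.Multiplicative_Group" "HOL-Algebra.Zassenhaus"
begin

text \<open>
  The core case is a central invariant subgroup \<open>A\<close> of a torsion group \<open>G\<close> with \<open>G/A\<close> abelian.
  The lower bound comes from \<open>T\<^sub>n(XY) = T\<^sub>n(X) T\<^sub>n(Y)\<close> for \<open>X \<subseteq> A\<close>. For the upper bound take a finite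
  \<open>F\<close> containing the identity such that \<open>AF\<close> is a subgroup. Then \<open>A T\<^sub>n(F)\<close> is a normal subgroup, and
  the equivalence relation on \<open>F\<close> that compares \<open>\<phi>\<^sup>n(f)\<close> modulo \<open>A T\<^sub>n(F)\<close> grows with \<open>n\<close>, hence is
  constant from some \<open>m\<close> on. With representatives \<open>R\<close> of its classes, a finite \<open>X \<subseteq> A\<close> collects the
  central errors made in rewriting products \<open>t \<phi>\<^sup>m(f)\<close> as \<open>s \<phi>\<^sup>m(r)\<close> with \<open>s, t \<in> T\<^sub>m(F)\<close> and \<open>r \<in> R\<close>.
  Applying powers of \<open>\<phi>\<close> gives \<open>|T\<^bsub>m+j\<^esub>(F)| \<le> |T\<^sub>m(F)| |R|\<^sup>j |T\<^sub>j(X)|\<close>, while \<open>F\<close> has entropy at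
  least \<open>log |R|\<close> in \<open>G/A\<close>.

  For \<open>G\<close> of class 2 and \<open>A = [G, G]\<close>, the core case applies to five sections:
  \<open>h(G) = h(A) + h(G/A)\<close>, \<open>h(G/A) = h(HA/A) + h(G/HA)\<close>, \<open>h(A) = h(H \<inter> A) + h(A/(H \<inter> A))\<close>,
  \<open>h(H) = h(H \<inter> A) + h(H/(H \<inter> A))\<close> and \<open>h(G/H) = h(HA/H) + h(G/HA)\<close>. Since
  \<open>HA/A \<cong> H/(H \<inter> A)\<close> and \<open>HA/H \<cong> A/(H \<inter> A)\<close>, they combine to \<open>h(G) = h(H) + h(G/H)\<close>.
\<close>

section \<open>Trajectories and entropy of sections\<close>

text \<open>Fekete's lemma: the limit is the infimum \<open>L\<close> of \<open>f n / real n\<close>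
  over positive \<open>n\<close>. Choosing \<open>m\<close> with \<open>f m / real m\<close> close
  to \<open>L\<close> and dividing with remainder, n = q m + r, bounds \<open>f n\<close> by
  \<open>q * f m\<close> plus one of finitely many values. Entropy is defined through
  \<open>lim\<close>, which is only usable once convergence is known.\<close>

lemma subadditive_convergent:
  fixes f :: "nat \<Rightarrow> real"
  assumes nonneg: "\<And>n. 0 \<le> f n" and sub: "\<And>m n. f (m + n) \<le> f m + f n"
  shows "convergent (\<lambda>n. f n / real n)"
proof -
  define L where "L = (INF n\<in>{1..}. f n / real n)"
  have bdd: "bdd_below ((\<lambda>n. f n / real n) ` {1..})"
    by (rule bdd_belowI[of _ 0]) (auto intro!: divide_nonneg_nonneg nonneg)
  have lower: "L \<le> f n / real n" if "n \<ge> 1" for n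
    unfolding L_def using that by (intro cINF_lower bdd) auto
  \<comment> \<open>The value \<open>f 0\<close> may be positive, so \<open>q = 0\<close> is
    excluded.\<close>
  have mult: "f (q * m) \<le> real q * f m" if "q \<ge> 1" for q m
    using that
  proof (induction q rule: nat_induct_at_least)
    case (Suc q)
    have "f (Suc q * m) \<le> f m + f (q * m)" using sub[of m "q * m"] by simp
    then show ?case using Suc by (simp add: algebra_simps)
  qed simp
  have "(\<lambda>n. f n / real n) \<longlonglongrightarrow> L"
  proof (rule LIMSEQ_I)
    fix e :: real assume e: "e > 0"
    have "\<exists>m\<in>{1..}. f m / real m < L + e / 2"
      using cINF_less_iff[OF _ bdd, of "L + e/2"] e unfolding L_def by auto
    then obtain m where m: "m \<ge> 1" "f m / real m < L + e / 2" by auto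
    define C where "C = Max (f ` {..m})"
    have C: "f i \<le> C" if "i \<le> m" for i unfolding C_def using that by (intro Max_ge) auto
    have C0: "C \<ge> 0" using C[of 0] nonneg[of 0] by simp
    obtain n0 :: nat where n0: "real n0 > 2 * C / e" using reals_Archimedean2 by blast
    show "\<exists>no. \<forall>n\<ge>no. norm (f n / real n - L) < e"
    proof (intro exI allI impI)
      \<comment> \<open>The summand \<open>m\<close> makes the quotient \<open>q\<close> positive,
        and \<open>n0\<close> makes the remainder term \<open>C / real n\<close> smaller than
        \<open>e / 2\<close>.\<close>
      fix n assume n: "n \<ge> Suc n0 + m"
      define q r where "q = n div m" and "r = n mod m"
      have nqr: "n = q * m + r" unfolding q_def r_def by simp
      have r: "r \<le> m" using m unfolding r_def by (simp add: less_imp_le)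
      have q1: "q \<ge> 1" unfolding q_def using n m by (simp add: div_greater_zero_iff Suc_le_eq)
      have "f n \<le> real q * f m + C"
        using sub[of "q * m" r] mult[OF q1, of m] C[OF r] nqr by simp
      also have "real q * f m = real (q * m) * (f m / real m)" using m by simp
      also have "\<dots> \<le> real n * (f m / real m)"
        using nqr by (intro mult_right_mono divide_nonneg_nonneg nonneg) auto
      finally have "f n / real n \<le> f m / real m + C / real n"
        using n by (simp add: field_simps)
      moreover have "C / real n < e / 2"
      proof -
        have "2 * C / e < real n" using n0 n by linarith
        then show ?thesis using e n by (simp add: field_simps)
      qed
      ultimately have "f n / real n < L + e" using m by linarith
      moreover have "L \<le> f n / real n" using n by (intro lower) auto
      ultimately show "norm (f n / real n - L) < e" by simp
    qed
  qed
  then show ?thesis by (auto simp: convergent_def)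
qed

text \<open>On \<open>Z\<close> the map \<open>p\<close> factors through \<open>q\<close>, by
  choosing preimages. Coset counts are compared in this way without constructing maps between coset
  spaces.\<close>

lemma card_image_le_factor:
  assumes "finite (q ` Z)" "\<And>a b. \<lbrakk>a \<in> Z; b \<in> Z; q a = q b\<rbrakk> \<Longrightarrow> p a = p b"
  shows "card (p ` Z) \<le> card (q ` Z)"
proof -
  have "p ` Z \<subseteq> (p \<circ> inv_into Z q) ` q ` Z"
  proof clarify
    fix z assume z: "z \<in> Z"
    have "p (inv_into Z q (q z)) = p z"
      by (rule assms(2)) (use z in \<open>auto simp: inv_into_into f_inv_into_f\<close>)
    then show "p z \<in> (p \<circ> inv_into Z q) ` q ` Z"
      using z by (metis comp_apply imageI)
  qed
  then show ?thesis by (meson assms(1) surj_card_le)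
qed

text \<open>Nonnegativity excludes minus infinity, so addition commutes with each supremum in turn,
  also when a supremum is infinite.\<close>

lemma SUP_add_le_ereal:
  fixes f :: "'i \<Rightarrow> ereal" and g :: "'j \<Rightarrow> ereal"
  assumes "I \<noteq> {}" "J \<noteq> {}" "\<And>i. i \<in> I \<Longrightarrow> 0 \<le> f i" "\<And>j. j \<in> J \<Longrightarrow> 0 \<le> g j"
    and le: "\<And>i j. \<lbrakk>i \<in> I; j \<in> J\<rbrakk> \<Longrightarrow> f i + g j \<le> c"
  shows "(SUP i\<in>I. f i) + (SUP j\<in>J. g j) \<le> c"
proof -
  obtain j where "j \<in> J" using assms(2) by blast
  then have "0 \<le> (SUP j\<in>J. g j)" using assms(4) by (intro SUP_upper2) auto
  then have "(SUP i\<in>I. f i) + (SUP j\<in>J. g j) = (SUP i\<in>I. f i + (SUP j\<in>J. g j))"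
    using assms(1) by (intro SUP_ereal_add_left[symmetric]) auto
  also have "\<dots> \<le> c"
  proof (rule SUP_least)
    fix i assume i: "i \<in> I"
    have "f i + (SUP j\<in>J. g j) = (SUP j\<in>J. f i + g j)"
      using assms(2) assms(3)[OF i] by (intro SUP_ereal_add_right[symmetric]) auto
    also have "\<dots> \<le> c" using le i by (auto intro: SUP_least)
    finally show "f i + (SUP j\<in>J. g j) \<le> c" .
  qed
  finally show ?thesis .
qed

section \<open>Products of subsets, cosets and homomorphisms\<close>

lemma card_set_mult_le:
  assumes "finite S" "finite T"
  shows "card (S <#>\<^bsub>G\<^esub> T) \<le> card S * card T"
proof -
  have "S <#>\<^bsub>G\<^esub> T = (\<lambda>(s, t). s \<otimes>\<^bsub>G\<^esub> t) ` (S \<times> T)" by (auto simp: set_mult_def)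
  then show ?thesis using card_image_le[of "S \<times> T"] assms by (simp add: card_cartesian_product)
qed

lemma finite_set_mult: "finite S \<Longrightarrow> finite T \<Longrightarrow> finite (S <#>\<^bsub>G\<^esub> T)"
  by (simp add: set_mult_def)

lemma set_mult_nonempty: "S \<noteq> {} \<Longrightarrow> T \<noteq> {} \<Longrightarrow> S <#>\<^bsub>G\<^esub> T \<noteq> {}"
  by (simp add: set_mult_def)

lemma set_multI: "s \<in> S \<Longrightarrow> t \<in> T \<Longrightarrow> s \<otimes>\<^bsub>G\<^esub> t \<in> S <#>\<^bsub>G\<^esub> T"
  by (auto simp: set_mult_def)

lemma set_multE:
  assumes "x \<in> S <#>\<^bsub>G\<^esub> T"
  obtains s t where "s \<in> S" "t \<in> T" "x = s \<otimes>\<^bsub>G\<^esub> t"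
  using assms by (auto simp: set_mult_def)

lemma (in group) rcos_eq_iff:
  assumes "subgroup N G" "a \<in> carrier G" "b \<in> carrier G"
  shows "N #> a = N #> b \<longleftrightarrow> a \<otimes> inv b \<in> N"
proof -
  have "a \<otimes> inv b \<in> N \<longleftrightarrow> a \<in> N #> b"
    using subgroup.rcos_module[OF assms(1) is_group assms(3,2)] by simp
  also have "\<dots> \<longleftrightarrow> N #> a = N #> b"
    using assms repr_independence rcos_self by metis
  finally show ?thesis by simp
qed

lemma (in group) hom_image_set_mult:
  assumes "h \<in> hom G K" "S \<subseteq> carrier G" "T \<subseteq> carrier G"
  shows "h ` (S <#> T) = h ` S <#>\<^bsub>K\<^esub> h ` T"
proof -
  have "h (s \<otimes> t) = h s \<otimes>\<^bsub>K\<^esub> h t" if "s \<in> S" "t \<in> T" for s t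
    using that assms hom_mult[of h G K] by blast
  then show ?thesis unfolding set_mult_def by (auto simp: image_iff; metis)
qed

definition trajectory_index ::
  "('a, 'b) monoid_scheme \<Rightarrow> ('a \<Rightarrow> 'a) \<Rightarrow> 'a set \<Rightarrow> 'a set \<Rightarrow> nat \<Rightarrow> nat" where
  "trajectory_index G \<phi> N X n = card ((\<lambda>x. N #>\<^bsub>G\<^esub> x) ` trajectory G \<phi> X n)"

definition section_entropy_wrt ::
  "('a, 'b) monoid_scheme \<Rightarrow> ('a \<Rightarrow> 'a) \<Rightarrow> 'a set \<Rightarrow> 'a set \<Rightarrow> real" where
  "section_entropy_wrt G \<phi> N X = lim (\<lambda>n. ln (real (trajectory_index G \<phi> N X n)) / real n)"

text \<open>The entropy of the endomorphism that \<open>\<phi>\<close> induces on \<open>K/N\<close>, computed inside \<open>G\<close> by counting cosets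
  of \<open>N\<close>.\<close>

definition section_entropy ::
  "('a, 'b) monoid_scheme \<Rightarrow> ('a \<Rightarrow> 'a) \<Rightarrow> 'a set \<Rightarrow> 'a set \<Rightarrow> ereal" where
  "section_entropy G \<phi> K N =
     (SUP X \<in> {X. finite X \<and> X \<noteq> {} \<and> X \<subseteq> K}. ereal (section_entropy_wrt G \<phi> N X))"

section \<open>Trajectories of an endomorphism\<close>

locale group_endo = group G for G (structure) +
  fixes \<phi> :: "'a \<Rightarrow> 'a"
  assumes endo: "\<phi> \<in> hom G G"
begin

abbreviation T where "T \<equiv> trajectory G \<phi>"

lemma pow_hom: "\<phi> ^^ n \<in> hom G G"
proof (induction n)
  case (Suc n)
  then show ?case using endo Group.hom_compose by (metis funpow.simps(2))
qed (simp add: hom_def)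

lemma pow_closed: "x \<in> carrier G \<Longrightarrow> (\<phi> ^^ n) x \<in> carrier G"
  using pow_hom hom_in_carrier by metis

lemma pow_image_closed: "X \<subseteq> carrier G \<Longrightarrow> (\<phi> ^^ n) ` X \<subseteq> carrier G"
  using pow_closed by blast

lemma pow_mult: "\<lbrakk>x \<in> carrier G; y \<in> carrier G\<rbrakk> \<Longrightarrow> (\<phi> ^^ n) (x \<otimes> y) = (\<phi> ^^ n) x \<otimes> (\<phi> ^^ n) y"
  using pow_hom hom_mult by metis

lemma pow_one: "(\<phi> ^^ n) \<one> = \<one>"
  using hom_one[OF pow_hom is_group is_group] .

lemma pow_inv: "x \<in> carrier G \<Longrightarrow> (\<phi> ^^ n) (inv x) = inv ((\<phi> ^^ n) x)"
  using group_hom.hom_inv[of G G "\<phi> ^^ n"] pow_hom is_group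
  by (simp add: group_hom_def group_hom_axioms_def)

lemma pow_invariant: "\<lbrakk>\<phi> ` K \<subseteq> K; x \<in> K\<rbrakk> \<Longrightarrow> (\<phi> ^^ n) x \<in> K"
  by (induction n) auto

lemma trajectory_carrier: "X \<subseteq> carrier G \<Longrightarrow> T X n \<subseteq> carrier G"
  by (induction n) (simp_all add: set_mult_closed pow_image_closed)

lemma finite_trajectory: "finite X \<Longrightarrow> finite (T X n)"
  by (induction n) (auto intro: finite_set_mult)

lemma trajectory_nonempty: "X \<noteq> {} \<Longrightarrow> T X n \<noteq> {}"
  by (induction n) (auto simp: set_mult_def)

lemma trajectory_mono: "X \<subseteq> Y \<Longrightarrow> T X n \<subseteq> T Y n"
  by (induction n) (simp_all add: mono_set_mult image_mono)

lemma trajectory_subset: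
  assumes "subgroup K G" "\<phi> ` K \<subseteq> K" "X \<subseteq> K"
  shows "T X n \<subseteq> K"
proof (induction n)
  case 0
  then show ?case using subgroup.one_closed[OF assms(1)] by simp
next
  case (Suc n)
  have "(\<phi> ^^ n) ` X \<subseteq> K" using pow_invariant[OF assms(2)] assms(3) by auto
  then show ?case using Suc mono_set_mult[of "T X n" K _ K G] subgroup_mult_id[OF assms(1)] by simp
qed

text \<open>The first \<open>m\<close> factors form one block; the others form the image under
  \<phi>^m of a trajectory of length \<open>n\<close>, since \<phi>^m is multiplicative. This allows
  a long product to be cut near its beginning or near its end.\<close>

lemma trajectory_add:
  assumes X: "X \<subseteq> carrier G"
  shows "T X (m + n) = T X m <#> (\<phi> ^^ m) ` T X n"
proof (induction n)
  case 0
  have "T X m <#> {\<one>} = T X m"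
    using trajectory_carrier[OF X, of m] by (force simp: set_mult_def)
  then show ?case by (simp add: pow_one)
next
  case (Suc n)
  have "(\<phi> ^^ (m + n)) ` X = (\<phi> ^^ m) ` (\<phi> ^^ n) ` X" by (simp add: funpow_add image_comp)
  then show ?case
    using Suc X trajectory_carrier[OF X] pow_image_closed
    by (simp add: hom_image_set_mult[OF pow_hom] set_mult_assoc)
qed

section \<open>Counting the cosets met by a trajectory\<close>

lemma trajectory_index_pos: "\<lbrakk>finite X; X \<noteq> {}\<rbrakk> \<Longrightarrow> trajectory_index G \<phi> N X n \<ge> 1"
  by (simp add: trajectory_index_def Suc_le_eq card_gt_0_iff finite_trajectory trajectory_nonempty)

lemma trajectory_index_mono:
  "\<lbrakk>finite Y; X \<subseteq> Y\<rbrakk> \<Longrightarrow> trajectory_index G \<phi> N X n \<le> trajectory_index G \<phi> N Y n"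
  unfolding trajectory_index_def by (intro card_mono image_mono finite_imageI finite_trajectory trajectory_mono)

text \<open>The coset of s \<phi>^m(t) depends only on the cosets of \<open>s\<close> and
  \<open>t\<close>: invariance of \<open>N\<close> lets \<phi>^m act on cosets, and normality makes
  the product of cosets well defined.\<close>

lemma trajectory_index_add:
  assumes N: "N \<lhd> G" "\<phi> ` N \<subseteq> N" and X: "finite X" "X \<subseteq> carrier G"
  shows "trajectory_index G \<phi> N X (m + n) \<le> trajectory_index G \<phi> N X m * trajectory_index G \<phi> N X n"
proof -
  have sub: "subgroup N G" using N normal_imp_subgroup by blast
  let ?p = "\<lambda>(s, t). N #> (s \<otimes> (\<phi> ^^ m) t)" and ?q = "map_prod (\<lambda>x. N #> x) (\<lambda>x. N #> x)"
  have "(\<lambda>x. N #> x) ` T X (m + n) = ?p ` (T X m \<times> T X n)"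
    unfolding trajectory_add[OF X(2)] by (auto simp: set_mult_def)
  moreover have "card (?p ` (T X m \<times> T X n)) \<le> card (?q ` (T X m \<times> T X n))"
  proof (rule card_image_le_factor)
    fix a b assume ab: "a \<in> T X m \<times> T X n" "b \<in> T X m \<times> T X n" and eq: "?q a = ?q b"
    obtain s t s' t' where [simp]: "a = (s, t)" "b = (s', t')" by (meson surj_pair)
    have c: "s \<in> carrier G" "t \<in> carrier G" "s' \<in> carrier G" "t' \<in> carrier G"
      using ab trajectory_carrier[OF X(2)] by auto
    have "t \<otimes> inv t' \<in> N" using eq c rcos_eq_iff[OF sub] by simp
    then have "(\<phi> ^^ m) (t \<otimes> inv t') \<in> N" by (rule pow_invariant[OF N(2)])
    then have "N #> (\<phi> ^^ m) t = N #> (\<phi> ^^ m) t'"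
      using c rcos_eq_iff[OF sub] by (simp add: pow_closed pow_mult pow_inv)
    moreover have "N #> s = N #> s'" using eq by simp
    ultimately have "(N #> s) <#> (N #> (\<phi> ^^ m) t) = (N #> s') <#> (N #> (\<phi> ^^ m) t')" by simp
    then show "?p a = ?p b" using c by (simp add: normal.rcos_sum[OF N(1)] pow_closed)
  qed (simp add: X finite_trajectory)
  ultimately show ?thesis
    by (simp add: trajectory_index_def map_prod_surj_on[OF refl refl] card_cartesian_product)
qed

text \<open>Submultiplicative coset counts have subadditive logarithms, and a nonempty
  \<open>X\<close> makes every count at least 1, so Fekete's lemma applies. Hence the
  \<open>lim\<close> in \<open>section_entropy_wrt\<close> is a genuine limit.\<close>

lemma section_entropy_wrt_LIMSEQ:
  assumes "N \<lhd> G" "\<phi> ` N \<subseteq> N" "finite X" "X \<noteq> {}" "X \<subseteq> carrier G"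
  shows "(\<lambda>n. ln (real (trajectory_index G \<phi> N X n)) / real n) \<longlonglongrightarrow> section_entropy_wrt G \<phi> N X"
proof -
  have pos: "trajectory_index G \<phi> N X n \<ge> 1" for n by (rule trajectory_index_pos[OF assms(3,4)])
  have "convergent (\<lambda>n. ln (real (trajectory_index G \<phi> N X n)) / real n)"
  proof (rule subadditive_convergent)
    fix m n
    show "0 \<le> ln (real (trajectory_index G \<phi> N X n))" using pos[of n] by simp
    have "real (trajectory_index G \<phi> N X (m + n))
        \<le> real (trajectory_index G \<phi> N X m) * real (trajectory_index G \<phi> N X n)"
      unfolding of_nat_mult[symmetric] of_nat_le_iff
      by (rule trajectory_index_add[OF assms(1,2,3,5)])
    then have "ln (real (trajectory_index G \<phi> N X (m + n)))
        \<le> ln (real (trajectory_index G \<phi> N X m) * real (trajectory_index G \<phi> N X n))"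
      using pos[of "m + n"] by (intro ln_mono) auto
    then show "ln (real (trajectory_index G \<phi> N X (m + n)))
        \<le> ln (real (trajectory_index G \<phi> N X m)) + ln (real (trajectory_index G \<phi> N X n))"
      using pos[of m] pos[of n] by (simp add: ln_mult)
  qed
  then show ?thesis unfolding section_entropy_wrt_def by (simp add: convergent_LIMSEQ_iff)
qed

lemma section_entropy_wrt_nonneg:
  assumes "N \<lhd> G" "\<phi> ` N \<subseteq> N" "finite X" "X \<noteq> {}" "X \<subseteq> carrier G"
  shows "0 \<le> section_entropy_wrt G \<phi> N X"
proof (rule LIMSEQ_le_const[OF section_entropy_wrt_LIMSEQ[OF assms]], intro exI allI impI)
  fix n
  show "0 \<le> ln (real (trajectory_index G \<phi> N X n)) / real n"
    using trajectory_index_pos[OF assms(3,4), of N n] by simp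
qed

lemma section_entropy_wrt_mono:
  assumes "N \<lhd> G" "\<phi> ` N \<subseteq> N" "finite Y" "X \<noteq> {}" "X \<subseteq> Y" "Y \<subseteq> carrier G"
  shows "section_entropy_wrt G \<phi> N X \<le> section_entropy_wrt G \<phi> N Y"
proof (rule LIMSEQ_le)
  have fin: "finite X" using assms finite_subset by blast
  show "(\<lambda>n. ln (real (trajectory_index G \<phi> N X n)) / real n) \<longlonglongrightarrow> section_entropy_wrt G \<phi> N X"
    "(\<lambda>n. ln (real (trajectory_index G \<phi> N Y n)) / real n) \<longlonglongrightarrow> section_entropy_wrt G \<phi> N Y"
    using assms fin by (auto intro!: section_entropy_wrt_LIMSEQ)
  have "ln (real (trajectory_index G \<phi> N X n)) \<le> ln (real (trajectory_index G \<phi> N Y n))" for n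
    using trajectory_index_pos[OF fin assms(4), of N n] trajectory_index_mono[OF assms(3,5), of N n]
    by (intro ln_mono) auto
  then show "\<exists>k. \<forall>n\<ge>k. ln (real (trajectory_index G \<phi> N X n)) / real n
      \<le> ln (real (trajectory_index G \<phi> N Y n)) / real n"
    by (intro exI allI impI divide_right_mono) auto
qed

lemma trajectory_index_one:
  assumes "X \<subseteq> carrier G"
  shows "trajectory_index G \<phi> {\<one>} X n = card (T X n)"
proof -
  have "inj_on (\<lambda>x. {\<one>} #> x) (T X n)"
    by (rule inj_on_subset[OF _ trajectory_carrier[OF assms]]) (simp add: inj_on_def r_coset_def)
  then show ?thesis by (simp add: trajectory_index_def card_image)
qed

text \<open>Cosets of the trivial subgroup are singletons, so counting them counts elements.\<close>

lemma algebraic_entropy_eq_section_entropy: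
  "algebraic_entropy G \<phi> = section_entropy G \<phi> (carrier G) {\<one>}"
  unfolding algebraic_entropy_def section_entropy_def
  by (intro SUP_cong refl)
    (simp add: entropy_wrt_def section_entropy_wrt_def trajectory_index_one)

end

text \<open>The map \<open>p\<close> carries trajectories to trajectories, and by \<open>pN\<close>
  it separates two elements of \<open>K\<close> modulo \<open>N'\<close> exactly when they are
  separated modulo \<open>N\<close>, so all coset counts agree. The kernel of \<open>p\<close> may
  be nontrivial, but it lies in \<open>N\<close>; this covers quotient maps as well as
  inclusions.\<close>

lemma section_entropy_transfer:
  fixes G :: "('a, 'b) monoid_scheme" and G' :: "('c, 'd) monoid_scheme"
  assumes G: "group_endo G \<phi>" and G': "group_endo G' \<phi>'"
    and K: "subgroup K G" "\<phi> ` K \<subseteq> K" and N: "subgroup N G" and N': "subgroup N' G'"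
    and p: "p \<in> hom (G\<lparr>carrier := K\<rparr>) G'" "p ` K = K'"
    and comm: "\<And>x. x \<in> K \<Longrightarrow> \<phi>' (p x) = p (\<phi> x)"
    and pN: "\<And>x. x \<in> K \<Longrightarrow> p x \<in> N' \<longleftrightarrow> x \<in> N"
  shows "section_entropy G \<phi> K N = section_entropy G' \<phi>' K' N'"
proof -
  interpret G: group_endo G \<phi> by fact
  interpret G': group_endo G' \<phi>' by fact
  have grp: "group (G\<lparr>carrier := K\<rparr>)" using G.subgroup_imp_group[OF K(1)] .
  have Kc: "K \<subseteq> carrier G" using K(1) subgroup.subset by blast
  have pm: "p (x \<otimes>\<^bsub>G\<^esub> y) = p x \<otimes>\<^bsub>G'\<^esub> p y" if "x \<in> K" "y \<in> K" for x y
    using hom_mult[OF p(1)] that by simp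
  have pc: "p x \<in> carrier G'" if "x \<in> K" for x
    using hom_in_carrier[OF p(1)] that by simp
  have pi: "p (inv\<^bsub>G\<^esub> x) = inv\<^bsub>G'\<^esub> p x" if "x \<in> K" for x
    using group_hom.hom_inv[of "G\<lparr>carrier := K\<rparr>" G' p x] that grp p(1) G'.is_group
      G.m_inv_consistent[OF K(1) that]
    by (simp add: group_hom_def group_hom_axioms_def)
  have p1: "p \<one>\<^bsub>G\<^esub> = \<one>\<^bsub>G'\<^esub>"
    using hom_one[OF p(1) grp G'.is_group] by simp
  have pow: "(\<phi>' ^^ n) (p x) = p ((\<phi> ^^ n) x)" if "x \<in> K" for x n
    by (induction n) (auto simp: comm G.pow_invariant[OF K(2) that])
  have traj: "trajectory G' \<phi>' (p ` X) n = p ` trajectory G \<phi> X n" if X: "X \<subseteq> K" for X n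
  proof (induction n)
    case (Suc n)
    have img: "(\<phi> ^^ n) ` X \<subseteq> K" using X G.pow_invariant[OF K(2)] by auto
    have "(\<phi>' ^^ n) ` p ` X = p ` (\<phi> ^^ n) ` X"
      unfolding image_image using X by (intro image_cong refl pow) auto
    then show ?case
      using Suc group.hom_image_set_mult[OF grp p(1), of "trajectory G \<phi> X n" "(\<phi> ^^ n) ` X"]
        G.trajectory_subset[OF K X, of n] img by simp
  qed (simp add: p1)
  have index: "trajectory_index G' \<phi>' N' (p ` X) n = trajectory_index G \<phi> N X n"
    if X: "finite X" "X \<subseteq> K" for X n
  proof -
    let ?T = "trajectory G \<phi> X n"
    have fin: "finite ?T" by (rule G.finite_trajectory[OF X(1)])
    have coset: "N' #>\<^bsub>G'\<^esub> p x = N' #>\<^bsub>G'\<^esub> p y \<longleftrightarrow> N #>\<^bsub>G\<^esub> x = N #>\<^bsub>G\<^esub> y"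
      if "x \<in> ?T" "y \<in> ?T" for x y
    proof -
      have xy: "x \<in> K" "y \<in> K" using that G.trajectory_subset[OF K X(2), of n] by auto
      then have inK: "x \<otimes>\<^bsub>G\<^esub> inv\<^bsub>G\<^esub> y \<in> K" using K(1) by (meson subgroup_def)
      have "p (x \<otimes>\<^bsub>G\<^esub> inv\<^bsub>G\<^esub> y) = p x \<otimes>\<^bsub>G'\<^esub> inv\<^bsub>G'\<^esub> p y"
        using xy pm pi subgroup.m_inv_closed[OF K(1)] by simp
      then have "N' #>\<^bsub>G'\<^esub> p x = N' #>\<^bsub>G'\<^esub> p y \<longleftrightarrow> x \<otimes>\<^bsub>G\<^esub> inv\<^bsub>G\<^esub> y \<in> N"
        using G'.rcos_eq_iff[OF N' pc pc, OF xy] pN[OF inK] by simp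
      then show ?thesis
        using G.rcos_eq_iff[OF N, of x y] xy Kc by blast
    qed
    have "card ((\<lambda>x. N' #>\<^bsub>G'\<^esub> p x) ` ?T) = card ((\<lambda>x. N #>\<^bsub>G\<^esub> x) ` ?T)"
      using fin coset by (intro antisym card_image_le_factor) auto
    then show ?thesis by (simp add: trajectory_index_def traj[OF X(2)] image_image)
  qed
  \<comment> \<open>A finite subset of \<open>K'\<close> lifts to a finite subset of
    \<open>K\<close>, so both suprema run over the same values.\<close>
  have sets: "{X. finite X \<and> X \<noteq> {} \<and> X \<subseteq> K'} = (\<lambda>X. p ` X) ` {X. finite X \<and> X \<noteq> {} \<and> X \<subseteq> K}"
  proof (intro equalityI subsetI)
    fix Y assume "Y \<in> {X. finite X \<and> X \<noteq> {} \<and> X \<subseteq> K'}"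
    then have Y: "finite Y" "Y \<noteq> {}" "Y \<subseteq> p ` K" using p(2) by auto
    then obtain X where "X \<subseteq> K" "finite X" "Y = p ` X" by (meson finite_subset_image)
    then show "Y \<in> (\<lambda>X. p ` X) ` {X. finite X \<and> X \<noteq> {} \<and> X \<subseteq> K}" using Y by auto
  qed (use p(2) in auto)
  show ?thesis
    unfolding section_entropy_def sets image_image
    by (intro SUP_cong refl) (simp add: section_entropy_wrt_def index)
qed

section \<open>Central subgroups with abelian quotient\<close>

text \<open>An index \<open>m\<close> at which the cardinality is largest works: every later set
  contains \<open>E m\<close> and has no more elements.\<close>

lemma mono_finite_sets_stabilise:
  fixes E :: "nat \<Rightarrow> 'a set"
  assumes "finite B" "\<And>n. E n \<subseteq> B" "\<And>n. E n \<subseteq> E (Suc n)"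
  obtains m where "\<And>n. n \<ge> m \<Longrightarrow> E n = E m"
proof -
  have "\<forall>n. card (E n) \<le> card B" using assms(1,2) by (simp add: card_mono)
  then obtain m where m: "\<And>n. card (E n) \<le> card (E m)"
    using ex_has_greatest_nat[of "\<lambda>_. True" 0 "\<lambda>n. card (E n)" "Suc (card B)"]
    by (auto simp: less_Suc_eq_le)
  have "E n = E m" if "n \<ge> m" for n
  proof -
    have "E m \<subseteq> E n" using lift_Suc_mono_le[of E m n] assms(3) that by blast
    then show ?thesis
      using m[of n] assms(1,2) by (metis card_seteq finite_subset)
  qed
  then show ?thesis using that by blast
qed

lemma (in group) set_mult_one_right: "S \<subseteq> carrier G \<Longrightarrow> S <#> {\<one>} = S"
  by (force simp: set_mult_def)

lemma (in group) subset_set_mult_right: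
  assumes "S \<subseteq> carrier G" "\<one> \<in> C"
  shows "S \<subseteq> S <#> C"
  using mono_set_mult[of S S "{\<one>}" C G] set_mult_one_right[OF assms(1)] assms(2) by simp

lemma (in group) subset_set_mult_left:
  assumes "S \<subseteq> carrier G" "\<one> \<in> C"
  shows "S \<subseteq> C <#> S"
proof
  fix s assume "s \<in> S"
  then show "s \<in> C <#> S" using assms set_multI[OF assms(2), of s S G] by auto
qed

lemma (in group) finite_generate_singleton:
  assumes "x \<in> carrier G" "n > 0" "x [^] (n::nat) = \<one>"
  shows "finite (generate G {x})"
proof -
  have "finite (carrier (subgroup_generated G {x}))"
    using finite_cyclic_subgroup[OF assms(1)] assms(2,3) by (metis less_numeral_extra(3))
  then show ?thesis using assms(1) by (simp add: carrier_subgroup_generated)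
qed

text \<open>The commutator condition says that \<open>G Mod A\<close> is abelian. It is stated on
  elements, so that it can be verified on representatives when \<open>G\<close> is itself a
  quotient.\<close>

locale central_endo = group_endo G \<phi> for G (structure) and \<phi> +
  fixes A :: "'a set"
  assumes A_subgroup: "subgroup A G"
    and A_central: "\<lbrakk>a \<in> A; x \<in> carrier G\<rbrakk> \<Longrightarrow> a \<otimes> x = x \<otimes> a"
    and A_commutators: "\<lbrakk>x \<in> carrier G; y \<in> carrier G\<rbrakk> \<Longrightarrow> x \<otimes> y \<otimes> inv x \<otimes> inv y \<in> A"
    and A_invariant: "\<phi> ` A \<subseteq> A"
begin

lemma A_carrier: "A \<subseteq> carrier G"
  using A_subgroup subgroup.subset by blast

text \<open>The conjugate of \<open>h\<close> by \<open>x\<close> is the commutator of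
  \<open>x\<close> and \<open>h\<close> times \<open>h\<close>, and the commutator lies in
  \<open>A\<close>.\<close>

lemma supergroup_normal:
  assumes P: "subgroup P G" "A \<subseteq> P"
  shows "P \<lhd> G"
proof (rule normal_invI[OF P(1)])
  fix x h assume xh: "x \<in> carrier G" "h \<in> P"
  then have h: "h \<in> carrier G" using P(1) subgroup.subset by blast
  have "x \<otimes> h \<otimes> inv x \<otimes> inv h \<in> P" using A_commutators xh(1) h P(2) by blast
  then have "x \<otimes> h \<otimes> inv x \<otimes> inv h \<otimes> h \<in> P" using xh(2) P(1) by (simp add: subgroup.m_closed)
  then show "x \<otimes> h \<otimes> inv x \<in> P" using xh h by (simp add: m_assoc)
qed

lemma A_normal: "A \<lhd> G"
  using supergroup_normal A_subgroup by blast

text \<open>Elements of \<open>Z\<close> are adjoined one at a time: \<open>F\<close> is multiplied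
  by the cyclic group of \<open>z\<close>, which is finite by torsion. The product remains a
  subgroup modulo \<open>A\<close> because \<open>A <#> F\<close> contains \<open>A\<close> and is
  therefore normal.\<close>

lemma ex_finite_subgroup_mod:
  assumes tor: "\<And>x. x \<in> carrier G \<Longrightarrow> \<exists>n::nat. n > 0 \<and> x [^] n = \<one>"
    and Z: "finite Z" "Z \<subseteq> carrier G"
  shows "\<exists>F. finite F \<and> Z \<subseteq> F \<and> \<one> \<in> F \<and> F \<subseteq> carrier G \<and> subgroup (A <#> F) G"
  using Z
proof (induction Z rule: finite_induct)
  case empty
  show ?case
    using A_subgroup A_carrier by (intro exI[of _ "{\<one>}"]) (simp add: set_mult_one_right)
next
  case (insert z Z)
  then obtain F where F: "finite F" "Z \<subseteq> F" "\<one> \<in> F" "F \<subseteq> carrier G" "subgroup (A <#> F) G" by auto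
  have z: "z \<in> carrier G" using insert by simp
  let ?C = "generate G {z}"
  have C: "subgroup ?C G" using generate_is_subgroup z by simp
  have C': "?C \<subseteq> carrier G" "\<one> \<in> ?C" "z \<in> ?C"
    using C subgroup.subset subgroup.one_closed by (auto intro: generate.incl)
  have "finite ?C" using tor[OF z] finite_generate_singleton[OF z] by blast
  have "A \<subseteq> A <#> F" by (rule subset_set_mult_right[OF A_carrier F(3)])
  then have "subgroup ((A <#> F) <#> ?C) G"
    using mult_norm_subgroup supergroup_normal F(5) C by blast
  moreover have "insert z Z \<subseteq> F <#> ?C"
    using F(2) subset_set_mult_right[OF F(4) C'(2)] subset_set_mult_left[OF C'(1) F(3)] C'(3) by blast
  moreover have "\<one> \<in> F <#> ?C" using set_multI[OF F(3) C'(2), where G = G] by simp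
  moreover have "finite (F <#> ?C)" using F(1) \<open>finite ?C\<close> by (rule finite_set_mult)
  ultimately show ?case
    using F(4) C'(1) A_carrier
    by (intro exI[of _ "F <#> ?C"]) (simp add: set_mult_assoc set_mult_closed)
qed

section \<open>Upper bound for a finite set that forms a subgroup together with
  \<open>A\<close>\<close>

context
  fixes F assumes F: "finite F" "\<one> \<in> F" "F \<subseteq> carrier G" "subgroup (A <#> F) G"
begin

lemma one_in_trajectory: "\<one> \<in> T F n"
proof (induction n)
  case (Suc n)
  have "\<one> \<in> (\<phi> ^^ n) ` F" using F(2) pow_one by (metis imageI)
  then show ?case using Suc set_multI[of \<one> "T F n" \<one> "(\<phi> ^^ n) ` F" G] by simp
qed simp

lemma A_subset_mod: "A \<subseteq> A <#> T F n"
  by (rule subset_set_mult_right[OF A_carrier one_in_trajectory])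

lemma trajectory_subset_mod: "T F n \<subseteq> A <#> T F n"
  by (rule subset_set_mult_left[OF trajectory_carrier[OF F(3)] subgroup.one_closed[OF A_subgroup]])

text \<open>In the inductive step the normal subgroup \<open>A <#> T F n\<close> is multiplied by
  the subgroup \<phi>^n(AF). The factor \<phi>^n(A) lies in \<open>A\<close> and is absorbed, which
  leaves \<open>A <#> T F (Suc n)\<close>.\<close>

lemma subgroup_mod: "subgroup (A <#> T F n) G"
proof (induction n)
  case 0
  show ?case using A_subgroup A_carrier by (simp add: set_mult_one_right)
next
  case (Suc n)
  let ?P = "A <#> T F n"
  have Tc: "T F n \<subseteq> carrier G" by (rule trajectory_carrier[OF F(3)])
  have Pc: "?P \<subseteq> carrier G" using Suc subgroup.subset by blast
  have "group_hom G G (\<phi> ^^ n)" using pow_hom by (simp add: group_hom_def group_hom_axioms_def)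
  then have "subgroup ((\<phi> ^^ n) ` (A <#> F)) G" using F(4) group_hom.subgroup_img_is_subgroup by blast
  then have "subgroup (?P <#> (\<phi> ^^ n) ` (A <#> F)) G"
    using mult_norm_subgroup supergroup_normal[OF Suc A_subset_mod] by blast
  moreover have "?P <#> (\<phi> ^^ n) ` (A <#> F) = A <#> T F (Suc n)"
  proof -
    have img: "(\<phi> ^^ n) ` A \<subseteq> A" using pow_invariant[OF A_invariant] by blast
    have "\<one> \<in> (\<phi> ^^ n) ` A" using subgroup.one_closed[OF A_subgroup] pow_one by (metis imageI)
    then have "?P \<subseteq> ?P <#> (\<phi> ^^ n) ` A" by (rule subset_set_mult_right[OF Pc])
    moreover have "?P <#> (\<phi> ^^ n) ` A \<subseteq> ?P"
      using mono_set_mult[of ?P ?P "(\<phi> ^^ n) ` A" ?P G] img A_subset_mod subgroup_mult_id[OF Suc] by blast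
    ultimately have "?P <#> (\<phi> ^^ n) ` A = ?P" by blast
    then show ?thesis
      using A_carrier F(3) Pc Tc pow_image_closed
      by (simp add: hom_image_set_mult[OF pow_hom] flip: set_mult_assoc)
  qed
  ultimately show ?case by simp
qed

lemma mod_carrier: "A <#> T F n \<subseteq> carrier G"
  using subgroup_mod subgroup.subset by blast

text \<open>Since \<open>F\<close> contains the identity, \<phi> of a trajectory of length
  \<open>n\<close> is part of the one of length \<open>n + 1\<close>, with first factor \<one>. This
  is what makes the relations \<open>E n\<close> in \<open>ex_representatives\<close>
  increase.\<close>

lemma image_mod: "\<phi> ` (A <#> T F n) \<subseteq> A <#> T F (Suc n)"
proof
  fix y assume "y \<in> \<phi> ` (A <#> T F n)"
  then obtain a t where at: "a \<in> A" "t \<in> T F n" "y = \<phi> (a \<otimes> t)" by (auto simp: set_mult_def)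
  have c: "a \<in> carrier G" "t \<in> carrier G" using at A_carrier trajectory_carrier[OF F(3)] by auto
  have "T F (1 + n) = T F 1 <#> \<phi> ` T F n" using trajectory_add[OF F(3), of 1 n] by simp
  moreover have "\<one> \<otimes> \<phi> t \<in> T F 1 <#> \<phi> ` T F n"
    using one_in_trajectory at(2) by (intro set_multI imageI)
  ultimately have "\<phi> t \<in> T F (Suc n)" using c pow_closed[of t 1] by simp
  moreover have "\<phi> a \<in> A" using at(1) A_invariant by blast
  ultimately show "y \<in> A <#> T F (Suc n)"
    using at(3) hom_mult[OF endo c] set_multI by metis
qed

text \<open>\<open>E n\<close> relates two elements of \<open>F\<close> whose images under \<phi>^n
  agree modulo \<open>A <#> T F n\<close>. These relations increase inside the finite set
  \<open>F \<times> F\<close>, hence are constant from some \<open>m\<close> on. Representatives of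
  the classes at \<open>m\<close> then remain inequivalent at every later \<open>n\<close>.\<close>

lemma ex_representatives:
  obtains m R where "R \<subseteq> F"
    "\<And>f. f \<in> F \<Longrightarrow> \<exists>r\<in>R. (\<phi> ^^ m) f \<otimes> inv (\<phi> ^^ m) r \<in> A <#> T F m"
    "\<And>n r s. \<lbrakk>n \<ge> m; r \<in> R; s \<in> R; (\<phi> ^^ n) r \<otimes> inv (\<phi> ^^ n) s \<in> A <#> T F n\<rbrakk> \<Longrightarrow> r = s"
proof -
  define E where "E n = {(f, g) \<in> F \<times> F. (\<phi> ^^ n) f \<otimes> inv (\<phi> ^^ n) g \<in> A <#> T F n}" for n
  have "E n \<subseteq> E (Suc n)" for n
  proof
    fix fg assume "fg \<in> E n"
    then obtain f g where fg: "fg = (f, g)" "f \<in> F" "g \<in> F" "(\<phi> ^^ n) f \<otimes> inv (\<phi> ^^ n) g \<in> A <#> T F n"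
      by (auto simp: E_def)
    have c: "f \<in> carrier G" "g \<in> carrier G" using fg F(3) by auto
    have "\<phi> ((\<phi> ^^ n) f \<otimes> inv (\<phi> ^^ n) g) \<in> A <#> T F (Suc n)" using fg(4) image_mod by blast
    then show "fg \<in> E (Suc n)"
      using fg(1-3) c pow_mult[of "(\<phi> ^^ n) f" "inv (\<phi> ^^ n) g" 1] pow_inv[of "(\<phi> ^^ n) g" 1]
      by (simp add: E_def pow_closed)
  qed
  moreover have "E n \<subseteq> F \<times> F" for n by (auto simp: E_def)
  ultimately obtain m where m: "\<And>n. n \<ge> m \<Longrightarrow> E n = E m"
    using mono_finite_sets_stabilise[of "F \<times> F" E] F(1) by blast
  let ?c = "\<lambda>f. (A <#> T F m) #> (\<phi> ^^ m) f"
  \<comment> \<open>\<open>R\<close> contains one element of \<open>F\<close> for each coset of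
    \<open>A <#> T F m\<close> met by \<phi>^m(F).\<close>
  obtain R where R: "R \<subseteq> F" "inj_on ?c R" "?c ` F = ?c ` R"
    using subset_image_inj[of "?c ` F" ?c F] by auto
  have eq: "?c f = ?c g \<longleftrightarrow> (f, g) \<in> E m" if "f \<in> F" "g \<in> F" for f g
  proof -
    have "(\<phi> ^^ m) f \<in> carrier G" "(\<phi> ^^ m) g \<in> carrier G" using that F(3) pow_closed by auto
    then show ?thesis using rcos_eq_iff[OF subgroup_mod] that by (simp add: E_def)
  qed
  show ?thesis
  proof (rule that[OF R(1)])
    fix f assume f: "f \<in> F"
    then have "?c f \<in> ?c ` R" using R(3) by blast
    then obtain r where r: "r \<in> R" "?c f = ?c r" by blast
    then have "(f, r) \<in> E m" using eq[of f r] f R(1) by auto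
    then show "\<exists>r\<in>R. (\<phi> ^^ m) f \<otimes> inv (\<phi> ^^ m) r \<in> A <#> T F m" using r(1) by (auto simp: E_def)
  next
    fix n r s
    assume *: "n \<ge> m" "r \<in> R" "s \<in> R" "(\<phi> ^^ n) r \<otimes> inv (\<phi> ^^ n) s \<in> A <#> T F n"
    then have "(r, s) \<in> E n" using R(1) by (auto simp: E_def)
    then have "(r, s) \<in> E m" using m[OF *(1)] by simp
    then have "?c r = ?c s" using eq[of r s] R(1) *(2,3) by blast
    then show "r = s" using inj_onD[OF R(2)] *(2,3) by blast
  qed
qed

text \<open>If \<open>r\<close> represents the class of \<open>f\<close>, then t \<phi>^m(f)
  \<phi>^m(r)^{-1} lies in the subgroup \<open>A <#> T F m\<close>, so it is x s with
  \<open>x\<close> in \<open>A\<close> and \<open>s\<close> in \<open>T F m\<close>; the central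
  \<open>x\<close> can be moved to the end. There are finitely many pairs (t, f), so one finite
  \<open>X\<close> holds a correction for each.\<close>

lemma ex_central_correction:
  assumes R: "R \<subseteq> F" "\<And>f. f \<in> F \<Longrightarrow> \<exists>r\<in>R. (\<phi> ^^ m) f \<otimes> inv (\<phi> ^^ m) r \<in> A <#> T F m"
  obtains X where "finite X" "X \<noteq> {}" "X \<subseteq> A"
    "\<And>t f. \<lbrakk>t \<in> T F m; f \<in> F\<rbrakk> \<Longrightarrow>
       \<exists>s\<in>T F m. \<exists>r\<in>R. \<exists>x\<in>X. t \<otimes> (\<phi> ^^ m) f = s \<otimes> (\<phi> ^^ m) r \<otimes> x"
proof -
  have "\<exists>x\<in>A. \<exists>s\<in>T F m. \<exists>r\<in>R. t \<otimes> (\<phi> ^^ m) f = s \<otimes> (\<phi> ^^ m) r \<otimes> x"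
    if t: "t \<in> T F m" and f: "f \<in> F" for t f
  proof -
    obtain r where r: "r \<in> R" "(\<phi> ^^ m) f \<otimes> inv (\<phi> ^^ m) r \<in> A <#> T F m" using R(2) f by blast
    have c: "t \<in> carrier G" "(\<phi> ^^ m) f \<in> carrier G" "(\<phi> ^^ m) r \<in> carrier G"
      using t f r(1) R(1) F(3) trajectory_carrier[OF F(3)] pow_closed by blast+
    have "t \<otimes> ((\<phi> ^^ m) f \<otimes> inv (\<phi> ^^ m) r) \<in> A <#> T F m"
      using subgroup.m_closed[OF subgroup_mod] trajectory_subset_mod t r(2) by blast
    then obtain x s where xs: "x \<in> A" "s \<in> T F m" "t \<otimes> ((\<phi> ^^ m) f \<otimes> inv (\<phi> ^^ m) r) = x \<otimes> s"
      by (auto elim: set_multE)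
    have c': "x \<in> carrier G" "s \<in> carrier G" using xs A_carrier trajectory_carrier[OF F(3)] by blast+
    have "t \<otimes> (\<phi> ^^ m) f = t \<otimes> ((\<phi> ^^ m) f \<otimes> inv (\<phi> ^^ m) r) \<otimes> (\<phi> ^^ m) r"
      using c by (simp add: m_assoc)
    also have "\<dots> = x \<otimes> (s \<otimes> (\<phi> ^^ m) r)" using xs(3) c c' by (simp add: m_assoc)
    also have "\<dots> = s \<otimes> (\<phi> ^^ m) r \<otimes> x" using A_central[OF xs(1)] c c' by simp
    finally show ?thesis using xs r(1) by blast
  qed
  then have "\<exists>x. x \<in> A \<and> (\<exists>s\<in>T F m. \<exists>r\<in>R. fst p \<otimes> (\<phi> ^^ m) (snd p) = s \<otimes> (\<phi> ^^ m) r \<otimes> x)"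
    if "p \<in> T F m \<times> F" for p
    using that[unfolded mem_Times_iff] by blast
  then have "\<forall>p\<in>T F m \<times> F. \<exists>x. x \<in> A \<and>
      (\<exists>s\<in>T F m. \<exists>r\<in>R. fst p \<otimes> (\<phi> ^^ m) (snd p) = s \<otimes> (\<phi> ^^ m) r \<otimes> x)" ..
  from bchoice[OF this] obtain x where "\<forall>p\<in>T F m \<times> F. x p \<in> A \<and>
      (\<exists>s\<in>T F m. \<exists>r\<in>R. fst p \<otimes> (\<phi> ^^ m) (snd p) = s \<otimes> (\<phi> ^^ m) r \<otimes> x p)" ..
  note x = bspec[OF this]
  show ?thesis
  proof (rule that[of "x ` (T F m \<times> F)"])
    show "finite (x ` (T F m \<times> F))" using F(1) finite_trajectory by blast
    show "x ` (T F m \<times> F) \<noteq> {}" using F(2) one_in_trajectory by blast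
    show "x ` (T F m \<times> F) \<subseteq> A" using x by blast
    show "\<exists>s\<in>T F m. \<exists>r\<in>R. \<exists>y\<in>x ` (T F m \<times> F). t \<otimes> (\<phi> ^^ m) f = s \<otimes> (\<phi> ^^ m) r \<otimes> y"
      if "t \<in> T F m" "f \<in> F" for t f
    proof -
      have p: "(t, f) \<in> T F m \<times> F" using that by blast
      then have "x (t, f) \<in> x ` (T F m \<times> F)" by (rule imageI)
      then show ?thesis using x[OF p] unfolding fst_conv snd_conv by blast
    qed
  qed
qed

text \<open>The induction shows that \<open>T F (m + j)\<close> lies in \<open>B <#> T X j\<close>
  for a set \<open>B\<close> of at most \<open>card (T F m) * card R ^ j\<close> elements. Each step
  multiplies \<open>B\<close> by \<phi>^{m+j}(R), and the new central correction extends
  \<open>T X j\<close> to \<open>T X (Suc j)\<close>.\<close>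

lemma card_trajectory_le:
  assumes R: "R \<subseteq> F" and X: "finite X" "X \<subseteq> A"
    and corr: "\<And>t f. \<lbrakk>t \<in> T F m; f \<in> F\<rbrakk> \<Longrightarrow>
       \<exists>s\<in>T F m. \<exists>r\<in>R. \<exists>x\<in>X. t \<otimes> (\<phi> ^^ m) f = s \<otimes> (\<phi> ^^ m) r \<otimes> x"
  shows "card (T F (m + j)) \<le> card (T F m) * card R ^ j * card (T X j)"
proof -
  have finR: "finite R" using R F(1) finite_subset by blast
  have Xc: "X \<subseteq> carrier G" using X(2) A_carrier by blast
  have "\<exists>B. B \<subseteq> carrier G \<and> finite B \<and> card B \<le> card (T F m) * card R ^ j \<and> T F (m + j) \<subseteq> B <#> T X j"
  proof (induction j)
    case 0
    show ?case
      using trajectory_carrier[OF F(3)] finite_trajectory[OF F(1)]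
      by (intro exI[of _ "T F m"]) (simp add: set_mult_one_right)
  next
    case (Suc j)
    then obtain B where B: "B \<subseteq> carrier G" "finite B" "card B \<le> card (T F m) * card R ^ j"
      "T F (m + j) \<subseteq> B <#> T X j" by blast
    let ?R = "(\<phi> ^^ (m + j)) ` R"
    have Rc: "?R \<subseteq> carrier G" using R F(3) pow_image_closed by blast
    have "card (B <#> ?R) \<le> card B * card ?R" using B(2) finR by (intro card_set_mult_le) auto
    also have "\<dots> \<le> (card (T F m) * card R ^ j) * card R"
      using B(3) finR by (intro mult_le_mono card_image_le)
    finally have card: "card (B <#> ?R) \<le> card (T F m) * card R ^ Suc j" by (simp add: mult_ac)
    have "T F (m + Suc j) \<subseteq> (B <#> ?R) <#> T X (Suc j)"
    proof
      fix y assume "y \<in> T F (m + Suc j)"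
      then have "y \<in> T F (m + j) <#> (\<phi> ^^ (m + j)) ` F" by simp
      then obtain u f where uf: "u \<in> T F (m + j)" "f \<in> F" "y = u \<otimes> (\<phi> ^^ (m + j)) f"
        by (auto elim: set_multE)
      \<comment> \<open>The prefix \<open>u\<close> is cut again so that its last \<open>m\<close>
        factors form \<phi>^j(t). Together with the new factor they are \<phi>^j applied to t
        \<phi>^m(f), where the correction rule is available.\<close>
      have "u \<in> T F j <#> (\<phi> ^^ j) ` T F m" using uf(1) trajectory_add[OF F(3), of j m] by (simp add: add.commute)
      then obtain v t where vt: "v \<in> T F j" "t \<in> T F m" "u = v \<otimes> (\<phi> ^^ j) t" by (auto elim: set_multE)
      obtain s r x where srx: "s \<in> T F m" "r \<in> R" "x \<in> X" "t \<otimes> (\<phi> ^^ m) f = s \<otimes> (\<phi> ^^ m) r \<otimes> x"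
        using corr[OF vt(2) uf(2)] by blast
      have c: "v \<in> carrier G" "t \<in> carrier G" "s \<in> carrier G" "f \<in> carrier G" "r \<in> carrier G" "x \<in> carrier G"
        using vt srx uf R F(3) Xc trajectory_carrier[OF F(3)] by blast+
      note pc = pow_closed[OF c(2)] pow_closed[OF c(3)] pow_closed[OF c(4)] pow_closed[OF c(5)] pow_closed[OF c(6)]
      have pow: "(\<phi> ^^ j) ((\<phi> ^^ m) z) = (\<phi> ^^ (m + j)) z" for z
        by (simp add: funpow_add add.commute[of m])
      have "(\<phi> ^^ j) t \<otimes> (\<phi> ^^ (m + j)) f = (\<phi> ^^ j) (t \<otimes> (\<phi> ^^ m) f)"
        using c pc by (simp add: pow_mult pow)
      also have "\<dots> = (\<phi> ^^ j) s \<otimes> (\<phi> ^^ (m + j)) r \<otimes> (\<phi> ^^ j) x"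
        using c pc by (simp add: srx(4) pow_mult pow)
      finally have y: "y = v \<otimes> (\<phi> ^^ j) s \<otimes> (\<phi> ^^ (m + j)) r \<otimes> (\<phi> ^^ j) x"
        using c pc by (simp add: uf(3) vt(3) m_assoc)
      \<comment> \<open>Replacing \<open>t\<close> by \<open>s\<close> keeps the prefix in the same
        trajectory, so the induction hypothesis covers it.\<close>
      have "v \<otimes> (\<phi> ^^ j) s \<in> T F (m + j)"
        using set_multI[OF vt(1) imageI[OF srx(1), of "\<phi> ^^ j"], of G] trajectory_add[OF F(3), of j m]
        by (simp add: add.commute)
      then obtain b z where bz: "b \<in> B" "z \<in> T X j" "v \<otimes> (\<phi> ^^ j) s = b \<otimes> z"
        using B(4) by (blast elim: set_multE)
      have zA: "z \<in> A" using bz(2) trajectory_subset[OF A_subgroup A_invariant X(2)] by blast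
      have c': "b \<in> carrier G" "z \<in> carrier G" using bz(1) B(1) zA A_carrier by blast+
      \<comment> \<open>The accumulated correction \<open>z\<close> is central and moves past the
        representative to meet the new correction.\<close>
      have "y = b \<otimes> (z \<otimes> (\<phi> ^^ (m + j)) r) \<otimes> (\<phi> ^^ j) x" using c' pc by (simp add: y bz(3) m_assoc)
      also have "\<dots> = (b \<otimes> (\<phi> ^^ (m + j)) r) \<otimes> (z \<otimes> (\<phi> ^^ j) x)"
        using c' pc A_central[OF zA] by (simp add: m_assoc)
      also have "\<dots> \<in> (B <#> ?R) <#> T X (Suc j)" using bz srx by (auto intro!: set_multI)
      finally show "y \<in> (B <#> ?R) <#> T X (Suc j)" .
    qed
    moreover have "B <#> ?R \<subseteq> carrier G" by (rule set_mult_closed[OF B(1) Rc])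
    moreover have "finite (B <#> ?R)" using B(2) finR by (intro finite_set_mult) auto
    ultimately show ?case using card by (intro exI[of _ "B <#> ?R"] conjI)
  qed
  then obtain B where B: "finite B" "card B \<le> card (T F m) * card R ^ j" "T F (m + j) \<subseteq> B <#> T X j" by blast
  have fin: "finite (T X j)" using finite_trajectory X(1) by blast
  have "card (T F (m + j)) \<le> card (B <#> T X j)" using B fin by (intro card_mono finite_set_mult)
  also have "\<dots> \<le> card B * card (T X j)" using B fin by (intro card_set_mult_le)
  also have "\<dots> \<le> card (T F m) * card R ^ j * card (T X j)" using B(2) by (rule mult_right_mono) simp
  finally show ?thesis .
qed

text \<open>Each step multiplies the number of cosets of \<open>A\<close> by at least
  \<open>card R\<close>: the coset of t \<phi>^n(r), for n = m + j, determines \<open>r\<close>,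
  because the \<phi>^n(r) are distinct even modulo \<open>A <#> T F n\<close>, and then it
  determines the coset of \<open>t\<close>.\<close>

lemma trajectory_index_ge:
  assumes R: "R \<subseteq> F"
    and inj: "\<And>n r s. \<lbrakk>n \<ge> m; r \<in> R; s \<in> R; (\<phi> ^^ n) r \<otimes> inv (\<phi> ^^ n) s \<in> A <#> T F n\<rbrakk> \<Longrightarrow> r = s"
  shows "card R ^ j \<le> trajectory_index G \<phi> A F (m + j)"
proof (induction j)
  case 0
  then show ?case using trajectory_index_pos[of F A m] F(1,2) by auto
next
  case (Suc j)
  let ?n = "m + j"
  let ?p = "\<lambda>(t, r). (A #> t, r)" and ?q = "\<lambda>(t, r). A #> (t \<otimes> (\<phi> ^^ ?n) r)"
  have finR: "finite R" using R F(1) finite_subset by blast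
  have fin: "finite (T F ?n \<times> R)" using finR finite_trajectory F(1) by blast
  have "card (?p ` (T F ?n \<times> R)) \<le> card (?q ` (T F ?n \<times> R))"
  proof (rule card_image_le_factor)
    fix a b assume ab: "a \<in> T F ?n \<times> R" "b \<in> T F ?n \<times> R" and q: "?q a = ?q b"
    obtain t r u s where [simp]: "a = (t, r)" "b = (u, s)" by (meson surj_pair)
    have rs: "r \<in> R" "s \<in> R" "t \<in> T F ?n" "u \<in> T F ?n" using ab by auto
    have c: "t \<in> carrier G" "u \<in> carrier G" "(\<phi> ^^ ?n) r \<in> carrier G" "(\<phi> ^^ ?n) s \<in> carrier G"
      using rs R F(3) pow_closed trajectory_carrier[OF F(3)] by blast+
    let ?P = "A <#> T F ?n"
    \<comment> \<open>Passing from \<open>A\<close> to the larger subgroup \<open>?P\<close> erases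
      the trajectory factors \<open>t\<close> and \<open>u\<close>, so that only \<open>r\<close>
      and \<open>s\<close> remain to be compared.\<close>
    have absorb: "?P #> (w \<otimes> g) = ?P #> g" if "w \<in> T F ?n" "g \<in> carrier G" for w g
    proof -
      have w: "w \<in> ?P" "w \<in> carrier G" using that trajectory_subset_mod trajectory_carrier[OF F(3)] by blast+
      then have "?P #> w = ?P" using coset_join2 subgroup_mod by blast
      then show ?thesis using coset_mult_assoc[OF mod_carrier w(2) that(2), of "m + j"] by simp
    qed
    have eq: "A #> (t \<otimes> (\<phi> ^^ ?n) r) = A #> (u \<otimes> (\<phi> ^^ ?n) s)" using q by simp
    then have "(t \<otimes> (\<phi> ^^ ?n) r) \<otimes> inv (u \<otimes> (\<phi> ^^ ?n) s) \<in> ?P"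
      using rcos_eq_iff[OF A_subgroup] c A_subset_mod by blast
    then have "?P #> (t \<otimes> (\<phi> ^^ ?n) r) = ?P #> (u \<otimes> (\<phi> ^^ ?n) s)"
      using rcos_eq_iff[OF subgroup_mod] c by blast
    then have "?P #> (\<phi> ^^ ?n) r = ?P #> (\<phi> ^^ ?n) s" using absorb c rs by simp
    then have r: "r = s" using rcos_eq_iff[OF subgroup_mod] c inj[of ?n r s] rs by simp
    have "A #> t = (A #> (t \<otimes> (\<phi> ^^ ?n) r)) #> inv (\<phi> ^^ ?n) r"
      using c A_carrier by (simp add: coset_mult_assoc m_assoc)
    also have "\<dots> = A #> u" unfolding eq using c A_carrier by (simp add: r coset_mult_assoc m_assoc)
    finally show "?p a = ?p b" using r by simp
  qed (use fin in simp)
  also have "?q ` (T F ?n \<times> R) \<subseteq> (\<lambda>x. A #> x) ` T F (m + Suc j)" using R by (auto simp: set_mult_def)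
  then have "card (?q ` (T F ?n \<times> R)) \<le> trajectory_index G \<phi> A F (m + Suc j)"
    unfolding trajectory_index_def by (rule card_mono[OF finite_imageI[OF finite_trajectory[OF F(1)]]])
  finally have "card (?p ` (T F ?n \<times> R)) \<le> trajectory_index G \<phi> A F (m + Suc j)" .
  moreover have "?p ` (T F ?n \<times> R) = (\<lambda>x. A #> x) ` T F ?n \<times> R" by (auto simp: image_iff)
  ultimately have "trajectory_index G \<phi> A F ?n * card R \<le> trajectory_index G \<phi> A F (m + Suc j)"
    by (simp add: card_cartesian_product trajectory_index_def)
  moreover have "card R ^ j * card R \<le> trajectory_index G \<phi> A F ?n * card R"
    by (rule mult_right_mono[OF Suc]) simp
  ultimately have "card R ^ j * card R \<le> trajectory_index G \<phi> A F (m + Suc j)" by (rule order_trans[rotated])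
  then show ?case by (simp only: power_Suc2)
qed

text \<open>\<open>ln (card R)\<close> links the two estimates. Taking logarithms and dividing by
  \<open>n\<close>, the upper bound on trajectories gives at most \<open>ln (card R)\<close> plus
  the entropy of \<open>X\<close>, while the lower bound on coset counts gives at least
  \<open>ln (card R)\<close> modulo \<open>A\<close>.\<close>

lemma section_entropy_wrt_le_add:
  obtains X where "finite X" "X \<noteq> {}" "X \<subseteq> A"
    "section_entropy_wrt G \<phi> {\<one>} F \<le> section_entropy_wrt G \<phi> {\<one>} X + section_entropy_wrt G \<phi> A F"
proof -
  obtain m R where R: "R \<subseteq> F"
    "\<And>f. f \<in> F \<Longrightarrow> \<exists>r\<in>R. (\<phi> ^^ m) f \<otimes> inv (\<phi> ^^ m) r \<in> A <#> T F m"
    "\<And>n r s. \<lbrakk>n \<ge> m; r \<in> R; s \<in> R; (\<phi> ^^ n) r \<otimes> inv (\<phi> ^^ n) s \<in> A <#> T F n\<rbrakk> \<Longrightarrow> r = s"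
    by (rule ex_representatives) (rule that)
  obtain X where X: "finite X" "X \<noteq> {}" "X \<subseteq> A"
    "\<And>t f. \<lbrakk>t \<in> T F m; f \<in> F\<rbrakk> \<Longrightarrow>
       \<exists>s\<in>T F m. \<exists>r\<in>R. \<exists>x\<in>X. t \<otimes> (\<phi> ^^ m) f = s \<otimes> (\<phi> ^^ m) r \<otimes> x"
    by (rule ex_central_correction[OF R(1) R(2)]) (assumption, rule that)
  have Xc: "X \<subseteq> carrier G" using X(3) A_carrier by blast
  have one: "{\<one>} \<lhd> G" "\<phi> ` {\<one>} \<subseteq> {\<one>}" using one_is_normal pow_one[of 1] by auto
  have Fne: "F \<noteq> {}" using F(2) by blast
  have lim1: "(\<lambda>n. ln (card (T Y n)) / n) \<longlonglongrightarrow> section_entropy_wrt G \<phi> {\<one>} Y"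
    if "finite Y" "Y \<noteq> {}" "Y \<subseteq> carrier G" for Y
    using section_entropy_wrt_LIMSEQ[OF one that] trajectory_index_one[OF that(3)] by simp
  have limA: "(\<lambda>n. ln (trajectory_index G \<phi> A F n) / n) \<longlonglongrightarrow> section_entropy_wrt G \<phi> A F"
    by (rule section_entropy_wrt_LIMSEQ[OF A_normal A_invariant F(1) Fne F(3)])
  have lim0: "(\<lambda>n. c / real n) \<longlonglongrightarrow> 0" for c by (rule lim_const_over_n)
  have Rpos: "card R > 0" using R(1,2) F(1,2) finite_subset card_gt_0_iff by blast
  have Tpos: "card (T Y n) > 0" if "finite Y" "Y \<noteq> {}" for Y n
    using that finite_trajectory trajectory_nonempty by (simp add: card_gt_0_iff)
  \<comment> \<open>The summand \<open>0\<close> is the limit of the contribution of the fixed set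
    \<open>T F m\<close>.\<close>
  have "section_entropy_wrt G \<phi> {\<one>} F \<le> 0 + ln (card R) + section_entropy_wrt G \<phi> {\<one>} X"
  proof (rule LIMSEQ_le)
    show "(\<lambda>n. ln (card (T F n)) / n) \<longlonglongrightarrow> section_entropy_wrt G \<phi> {\<one>} F"
      by (rule lim1[OF F(1) Fne F(3)])
    show "(\<lambda>n. ln (card (T F m)) / n + ln (card R) + ln (card (T X n)) / n)
        \<longlonglongrightarrow> 0 + ln (card R) + section_entropy_wrt G \<phi> {\<one>} X"
      by (intro tendsto_add lim0 tendsto_const lim1 X(1,2) Xc)
    show "\<exists>k. \<forall>n\<ge>k. ln (card (T F n)) / n
        \<le> ln (card (T F m)) / n + ln (card R) + ln (card (T X n)) / n"
    proof (intro exI[of _ 1] allI impI)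
      fix n :: nat assume n: "n \<ge> 1"
      \<comment> \<open>Since \<one> lies in every trajectory of \<open>F\<close>, enlarging the
        length by \<open>m\<close> loses nothing, and the limit can be taken along \<open>n\<close>
        itself.\<close>
      have "T F n \<subseteq> T F (m + n)"
      proof -
        have "\<one> \<in> (\<phi> ^^ n) ` T F m" using one_in_trajectory pow_one by (metis imageI)
        then show ?thesis
          using subset_set_mult_right[OF trajectory_carrier[OF F(3)]] trajectory_add[OF F(3), of n m]
          by (simp add: add.commute)
      qed
      then have "card (T F n) \<le> card (T F (m + n))" using finite_trajectory[OF F(1)] by (rule card_mono[rotated])
      also have "\<dots> \<le> card (T F m) * card R ^ n * card (T X n)"
        by (rule card_trajectory_le[OF R(1) X(1,3,4)])
      finally have "real (card (T F n)) \<le> real (card (T F m)) * real (card R) ^ n * real (card (T X n))"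
        by (metis of_nat_le_iff of_nat_mult of_nat_power)
      then have "ln (card (T F n)) \<le> ln (real (card (T F m)) * real (card R) ^ n * real (card (T X n)))"
        using Tpos[OF F(1) Fne] by (intro ln_mono) auto
      also have "\<dots> = ln (card (T F m)) + n * ln (card R) + ln (card (T X n))"
        using Tpos[OF F(1) Fne, of m] Tpos[OF X(1,2), of n] Rpos by (simp add: ln_mult ln_realpow)
      finally show "ln (card (T F n)) / n \<le> ln (card (T F m)) / n + ln (card R) + ln (card (T X n)) / n"
        using n by (simp add: field_simps)
    qed
  qed
  moreover have "ln (card R) \<le> 0 + section_entropy_wrt G \<phi> A F"
  proof (rule LIMSEQ_le_const)
    show "(\<lambda>n. ln (trajectory_index G \<phi> A F m) / n + ln (trajectory_index G \<phi> A F n) / n)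
        \<longlonglongrightarrow> 0 + section_entropy_wrt G \<phi> A F"
      by (intro tendsto_add lim0 limA)
    show "\<exists>k. \<forall>n\<ge>k. ln (card R) \<le> ln (trajectory_index G \<phi> A F m) / n + ln (trajectory_index G \<phi> A F n) / n"
    \<comment> \<open>Division by zero yields 0, so the bound can fail at \<open>n = 0\<close> and
      is claimed from 1 on.\<close>
    proof (intro exI[of _ 1] allI impI)
      fix n :: nat assume n: "n \<ge> 1"
      note pos = trajectory_index_pos[OF F(1) Fne, of A]
      \<comment> \<open>Submultiplicativity turns the shift by \<open>m\<close> into a constant
        factor, which vanishes after dividing its logarithm by \<open>n\<close>.\<close>
      have "card R ^ n \<le> trajectory_index G \<phi> A F m * trajectory_index G \<phi> A F n"
      proof (rule order_trans)
        show "card R ^ n \<le> trajectory_index G \<phi> A F (m + n)"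
          by (rule trajectory_index_ge[OF R(1)]) (rule R(3))
        show "trajectory_index G \<phi> A F (m + n) \<le> trajectory_index G \<phi> A F m * trajectory_index G \<phi> A F n"
          by (rule trajectory_index_add[OF A_normal A_invariant F(1,3)])
      qed
      then have "real (card R) ^ n \<le> real (trajectory_index G \<phi> A F m) * real (trajectory_index G \<phi> A F n)"
        by (metis of_nat_le_iff of_nat_mult of_nat_power)
      then have "ln (real (card R) ^ n)
          \<le> ln (real (trajectory_index G \<phi> A F m) * real (trajectory_index G \<phi> A F n))"
        using Rpos by (intro ln_mono) auto
      then have "n * ln (card R) \<le> ln (trajectory_index G \<phi> A F m) + ln (trajectory_index G \<phi> A F n)"
        using pos[of m] pos[of n] Rpos by (simp add: ln_mult ln_realpow)
      then show "ln (card R) \<le> ln (trajectory_index G \<phi> A F m) / n + ln (trajectory_index G \<phi> A F n) / n"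
        using n by (simp add: field_simps)
    qed
  qed
  ultimately show ?thesis using that[OF X(1-3)] by linarith
qed

end

text \<open>The trajectory of \<open>X\<close> stays in the central subgroup \<open>A\<close>, so
  its factors interleave freely with those of \<open>Y\<close>. Thus the trajectory of the product
  set contains the product of the two trajectories, whose size is at least the size of the first
  times the number of cosets of \<open>A\<close> met by the second.\<close>

lemma add_le_section_entropy_wrt:
  assumes X: "finite X" "X \<noteq> {}" "X \<subseteq> A" and Y: "finite Y" "Y \<noteq> {}" "Y \<subseteq> carrier G"
  shows "section_entropy_wrt G \<phi> {\<one>} X + section_entropy_wrt G \<phi> A Y
    \<le> section_entropy_wrt G \<phi> {\<one>} (X <#> Y)"
proof (rule LIMSEQ_le)
  have Xc: "X \<subseteq> carrier G" using X(3) A_carrier by blast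
  have XY: "finite (X <#> Y)" "X <#> Y \<noteq> {}" "X <#> Y \<subseteq> carrier G"
    using finite_set_mult[OF X(1) Y(1)] set_mult_nonempty[OF X(2) Y(2)] set_mult_closed[OF Xc Y(3)] .
  have one: "{\<one>} \<lhd> G" "\<phi> ` {\<one>} \<subseteq> {\<one>}" using one_is_normal pow_one[of 1] by auto
  show "(\<lambda>n. ln (trajectory_index G \<phi> {\<one>} (X <#> Y) n) / n) \<longlonglongrightarrow> section_entropy_wrt G \<phi> {\<one>} (X <#> Y)"
    by (rule section_entropy_wrt_LIMSEQ[OF one XY])
  show "(\<lambda>n. ln (trajectory_index G \<phi> {\<one>} X n) / n + ln (trajectory_index G \<phi> A Y n) / n)
      \<longlonglongrightarrow> section_entropy_wrt G \<phi> {\<one>} X + section_entropy_wrt G \<phi> A Y"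
    by (intro tendsto_add section_entropy_wrt_LIMSEQ one A_normal A_invariant X(1,2) Xc Y)
  have sub: "T X n <#> T Y n \<subseteq> T (X <#> Y) n" for n
  proof (induction n)
    case 0
    show ?case by (simp add: set_mult_def)
  next
    case (Suc n)
    show ?case
    proof
      fix w assume "w \<in> T X (Suc n) <#> T Y (Suc n)"
      then obtain x t y u where xy: "t \<in> T X n" "x \<in> X" "u \<in> T Y n" "y \<in> Y"
        "w = (t \<otimes> (\<phi> ^^ n) x) \<otimes> (u \<otimes> (\<phi> ^^ n) y)"
        by (auto simp: set_mult_def)
      have c: "t \<in> carrier G" "u \<in> carrier G" "x \<in> carrier G" "y \<in> carrier G"
        using xy Xc Y(3) trajectory_carrier by blast+
      have xA: "(\<phi> ^^ n) x \<in> A" using xy(2) X(3) pow_invariant[OF A_invariant] by blast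
      have "w = t \<otimes> ((\<phi> ^^ n) x \<otimes> u) \<otimes> (\<phi> ^^ n) y" using xy(5) c by (simp add: m_assoc pow_closed)
      also have "\<dots> = (t \<otimes> u) \<otimes> (\<phi> ^^ n) (x \<otimes> y)"
        using A_central[OF xA c(2)] c by (simp add: m_assoc pow_closed pow_mult)
      also have "\<dots> \<in> T (X <#> Y) (Suc n)"
        using Suc xy(1-4) by (auto intro!: set_multI)
      finally show "w \<in> T (X <#> Y) (Suc n)" .
    qed
  qed
  show "\<exists>k. \<forall>n\<ge>k. ln (trajectory_index G \<phi> {\<one>} X n) / n + ln (trajectory_index G \<phi> A Y n) / n
      \<le> ln (trajectory_index G \<phi> {\<one>} (X <#> Y) n) / n"
  proof (intro exI allI impI)
    fix n
    obtain R where R: "R \<subseteq> T Y n" "inj_on (\<lambda>x. A #> x) R" "(\<lambda>x. A #> x) ` T Y n = (\<lambda>x. A #> x) ` R"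
      using subset_image_inj[of "(\<lambda>x. A #> x) ` T Y n" "\<lambda>x. A #> x" "T Y n"] by auto
    have Rc: "R \<subseteq> carrier G" using R(1) trajectory_carrier[OF Y(3)] by blast
    have TA: "T X n \<subseteq> A" by (rule trajectory_subset[OF A_subgroup A_invariant X(3)])
    \<comment> \<open>Reducing modulo \<open>A\<close> recovers \<open>r\<close>, one representative
      per coset; cancellation then recovers \<open>x\<close>.\<close>
    have "inj_on (\<lambda>(x, r). x \<otimes> r) (T X n \<times> R)"
    proof (rule inj_onI, clarify)
      fix x r x' r' assume *: "x \<in> T X n" "r \<in> R" "x' \<in> T X n" "r' \<in> R" "x \<otimes> r = x' \<otimes> r'"
      have c: "r \<in> carrier G" "r' \<in> carrier G" "x \<in> carrier G" "x' \<in> carrier G" "x \<in> A" "x' \<in> A"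
        using * Rc TA A_carrier by blast+
      have "A #> (x \<otimes> r) = A #> r" "A #> (x' \<otimes> r') = A #> r'"
        using c A_carrier coset_join2[OF _ A_subgroup] by (simp_all flip: coset_mult_assoc)
      then have "r = r'" using *(2,4,5) R(2) by (metis inj_onD)
      then show "x = x' \<and> r = r'" using *(5) c by simp
    qed
    then have "card (T X n) * card R = card ((\<lambda>(x, r). x \<otimes> r) ` (T X n \<times> R))"
      by (simp add: card_image card_cartesian_product)
    also have "\<dots> \<le> card (T (X <#> Y) n)"
      using sub[of n] R(1) finite_trajectory[OF XY(1)] by (intro card_mono) (auto simp: set_mult_def)
    finally have "trajectory_index G \<phi> {\<one>} X n * trajectory_index G \<phi> A Y n
        \<le> trajectory_index G \<phi> {\<one>} (X <#> Y) n"
      using R(2,3) by (simp add: trajectory_index_one Xc XY trajectory_index_def[of G \<phi> A Y] card_image)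
    then have "real (trajectory_index G \<phi> {\<one>} X n) * real (trajectory_index G \<phi> A Y n)
        \<le> real (trajectory_index G \<phi> {\<one>} (X <#> Y) n)"
      by (metis of_nat_le_iff of_nat_mult)
    moreover have pos: "real (trajectory_index G \<phi> {\<one>} X n) > 0" "real (trajectory_index G \<phi> A Y n) > 0"
      using trajectory_index_pos[OF X(1,2), of "{\<one>}" n] trajectory_index_pos[OF Y(1,2), of A n] by simp_all
    ultimately have "ln (trajectory_index G \<phi> {\<one>} X n) + ln (trajectory_index G \<phi> A Y n)
        \<le> ln (trajectory_index G \<phi> {\<one>} (X <#> Y) n)"
      by (subst ln_mult_pos[symmetric]) (auto intro!: ln_mono)
    then show "ln (trajectory_index G \<phi> {\<one>} X n) / n + ln (trajectory_index G \<phi> A Y n) / n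
        \<le> ln (trajectory_index G \<phi> {\<one>} (X <#> Y) n) / n"
      by (simp add: divide_right_mono flip: add_divide_distrib)
  qed
qed

text \<open>For \<le>, torsion allows each finite \<open>Z\<close> to be enlarged to an
  \<open>F\<close> that forms a subgroup together with \<open>A\<close>, and entropy is monotone.
  For \<ge>, each pair \<open>X\<close>, \<open>Y\<close> is replaced by \<open>X <#> Y\<close> and
  the two suprema are taken independently.\<close>

theorem section_entropy_add:
  assumes tor: "\<And>x. x \<in> carrier G \<Longrightarrow> \<exists>n::nat. n > 0 \<and> x [^] n = \<one>"
  shows "section_entropy G \<phi> (carrier G) {\<one>}
    = section_entropy G \<phi> A {\<one>} + section_entropy G \<phi> (carrier G) A"
proof (rule antisym)
  have one: "{\<one>} \<lhd> G" "\<phi> ` {\<one>} \<subseteq> {\<one>}" using one_is_normal pow_one[of 1] by auto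
  have 1: "\<one> \<in> A" "\<one> \<in> carrier G" using subgroup.one_closed[OF A_subgroup] by auto
  show "section_entropy G \<phi> (carrier G) {\<one>}
    \<le> section_entropy G \<phi> A {\<one>} + section_entropy G \<phi> (carrier G) A"
    unfolding section_entropy_def[of G \<phi> "carrier G" "{\<one>}"]
  proof (rule SUP_least)
    fix Z assume "Z \<in> {X. finite X \<and> X \<noteq> {} \<and> X \<subseteq> carrier G}"
    then have Z: "finite Z" "Z \<noteq> {}" "Z \<subseteq> carrier G" by auto
    obtain F where F: "finite F" "Z \<subseteq> F" "\<one> \<in> F" "F \<subseteq> carrier G" "subgroup (A <#> F) G"
      using ex_finite_subgroup_mod[OF tor Z(1,3)] by blast
    obtain X where X: "finite X" "X \<noteq> {}" "X \<subseteq> A"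
      "section_entropy_wrt G \<phi> {\<one>} F \<le> section_entropy_wrt G \<phi> {\<one>} X + section_entropy_wrt G \<phi> A F"
      using section_entropy_wrt_le_add[OF F(1,3,4,5)] by blast
    have "ereal (section_entropy_wrt G \<phi> {\<one>} Z) \<le> ereal (section_entropy_wrt G \<phi> {\<one>} F)"
      using section_entropy_wrt_mono[OF one F(1) Z(2) F(2,4)] by simp
    also have "\<dots> \<le> ereal (section_entropy_wrt G \<phi> {\<one>} X) + ereal (section_entropy_wrt G \<phi> A F)"
      using X(4) by simp
    also have "\<dots> \<le> section_entropy G \<phi> A {\<one>} + section_entropy G \<phi> (carrier G) A"
      unfolding section_entropy_def using X F by (intro add_mono SUP_upper) auto
    finally show "ereal (section_entropy_wrt G \<phi> {\<one>} Z)
      \<le> section_entropy G \<phi> A {\<one>} + section_entropy G \<phi> (carrier G) A" .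
  qed
  show "section_entropy G \<phi> A {\<one>} + section_entropy G \<phi> (carrier G) A
    \<le> section_entropy G \<phi> (carrier G) {\<one>}"
    unfolding section_entropy_def[of G \<phi> A] section_entropy_def[of G \<phi> "carrier G" A]
  proof (rule SUP_add_le_ereal)
    fix X Y assume "X \<in> {X. finite X \<and> X \<noteq> {} \<and> X \<subseteq> A}" "Y \<in> {X. finite X \<and> X \<noteq> {} \<and> X \<subseteq> carrier G}"
    then have X: "finite X" "X \<noteq> {}" "X \<subseteq> A" and Y: "finite Y" "Y \<noteq> {}" "Y \<subseteq> carrier G" by auto
    have "X <#> Y \<in> {X. finite X \<and> X \<noteq> {} \<and> X \<subseteq> carrier G}"
      using X Y A_carrier finite_set_mult[of X Y G] set_mult_nonempty[of X Y G] set_mult_closed[of X Y]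
      by blast
    then show "ereal (section_entropy_wrt G \<phi> {\<one>} X) + ereal (section_entropy_wrt G \<phi> A Y)
        \<le> section_entropy G \<phi> (carrier G) {\<one>}"
      using add_le_section_entropy_wrt[OF X Y] unfolding section_entropy_def by (intro SUP_upper2) auto
  qed (use 1 A_carrier A_normal A_invariant one in \<open>auto intro!: section_entropy_wrt_nonneg\<close>)
qed

end

section \<open>Towers of sections\<close>

lemma hom_restrict_domain:
  assumes "h \<in> hom G Q" "K \<subseteq> carrier G"
  shows "h \<in> hom (G\<lparr>carrier := K\<rparr>) Q"
  by (rule homI) (use assms in \<open>simp_all add: subset_iff hom_in_carrier[OF assms(1)] hom_mult[OF assms(1)]\<close>)

context group_endo
begin

section \<open>Restrictions and quotients as sections\<close>

lemma restrict_endo: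
  assumes "subgroup K G" "\<phi> ` K \<subseteq> K"
  shows "group_endo (G\<lparr>carrier := K\<rparr>) (restrict \<phi> K)"
proof -
  have "restrict \<phi> K \<in> hom (G\<lparr>carrier := K\<rparr>) (G\<lparr>carrier := K\<rparr>)"
  proof (rule homI)
    fix x y assume "x \<in> carrier (G\<lparr>carrier := K\<rparr>)" "y \<in> carrier (G\<lparr>carrier := K\<rparr>)"
    then have xy: "x \<in> K" "y \<in> K" by simp_all
    then have "\<phi> (x \<otimes> y) = \<phi> x \<otimes> \<phi> y"
      using hom_mult[OF endo] subgroup.subset[OF assms(1)] by blast
    then show "restrict \<phi> K (x \<otimes>\<^bsub>G\<lparr>carrier := K\<rparr>\<^esub> y)
        = restrict \<phi> K x \<otimes>\<^bsub>G\<lparr>carrier := K\<rparr>\<^esub> restrict \<phi> K y"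
      using xy subgroup.m_closed[OF assms(1)] by simp
  qed (use assms(2) in auto)
  then show ?thesis
    using subgroup_imp_group[OF assms(1)] by (simp add: group_endo_def group_endo_axioms_def)
qed

lemma factor_endo:
  assumes "N \<lhd> G" "\<phi> ` N \<subseteq> N"
  shows "group_endo (G Mod N) (induced_endo G N \<phi>)"
  using normal.factorgroup_is_group[OF assms(1)] induced_endo_hom[OF assms(1) endo assms(2)]
  by (simp add: group_endo_def group_endo_axioms_def)

text \<open>Transfer along the inclusion of \<open>K\<close>: \<open>restrict\<close> changes \<phi>
  only outside \<open>K\<close>, where no trajectory of a subset of \<open>K\<close> goes.\<close>

lemma algebraic_entropy_restrict:
  assumes "subgroup K G" "\<phi> ` K \<subseteq> K"
  shows "algebraic_entropy (G\<lparr>carrier := K\<rparr>) (restrict \<phi> K) = section_entropy G \<phi> K {\<one>}"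
proof -
  interpret K: group_endo "G\<lparr>carrier := K\<rparr>" "restrict \<phi> K" by (rule restrict_endo[OF assms])
  have "section_entropy G \<phi> K {\<one>}
      = section_entropy (G\<lparr>carrier := K\<rparr>) (restrict \<phi> K) K {\<one>\<^bsub>G\<lparr>carrier := K\<rparr>\<^esub>}"
    by (rule section_entropy_transfer[where p = "\<lambda>x. x"])
      (use assms group_endo_axioms K.group_endo_axioms triv_subgroup K.triv_subgroup in \<open>auto simp: hom_def\<close>)
  then show ?thesis using K.algebraic_entropy_eq_section_entropy by simp
qed

lemma rcos_eq_self_iff: "subgroup N G \<Longrightarrow> x \<in> carrier G \<Longrightarrow> N #> x = N \<longleftrightarrow> x \<in> N"
  using coset_join1 coset_join2 subgroup.subset by metis

text \<open>Transfer along the quotient map. Asking \<open>L\<close> and \<open>N\<close> to agree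
  only on \<open>K\<close> covers both \<open>L = N\<close> and \<open>L = K \<inter> N\<close>, the
  two cases of the second isomorphism theorem.\<close>

lemma section_entropy_factor:
  assumes N: "N \<lhd> G" "\<phi> ` N \<subseteq> N" and K: "subgroup K G" "\<phi> ` K \<subseteq> K"
    and L: "subgroup L G" "\<And>x. x \<in> K \<Longrightarrow> x \<in> L \<longleftrightarrow> x \<in> N"
  shows "section_entropy G \<phi> K L
    = section_entropy (G Mod N) (induced_endo G N \<phi>) ((\<lambda>x. N #> x) ` K) {N}"
proof -
  interpret Q: group_endo "G Mod N" "induced_endo G N \<phi>" by (rule factor_endo[OF N])
  have Kc: "K \<subseteq> carrier G" using K(1) subgroup.subset by blast
  have Ns: "subgroup N G" using N(1) normal_imp_subgroup by blast
  show ?thesis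
  proof (rule section_entropy_transfer[where p = "\<lambda>x. N #> x"])
    show "subgroup {N} (G Mod N)" using Q.triv_subgroup by simp
    show "(\<lambda>x. N #> x) \<in> hom (G\<lparr>carrier := K\<rparr>) (G Mod N)"
      by (rule hom_restrict_domain[OF normal.r_coset_hom_Mod[OF N(1)] Kc])
    show "induced_endo G N \<phi> (N #> x) = N #> \<phi> x" if "x \<in> K" for x
      using induced_endo_rcos[OF N(1) endo N(2)] that Kc by blast
    show "N #> x \<in> {N} \<longleftrightarrow> x \<in> L" if "x \<in> K" for x
      using L(2)[OF that] rcos_eq_self_iff[OF Ns] that Kc by auto
  qed (use K L group_endo_axioms Q.group_endo_axioms in auto)
qed

lemma algebraic_entropy_factor:
  assumes N: "N \<lhd> G" "\<phi> ` N \<subseteq> N"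
  shows "algebraic_entropy (G Mod N) (induced_endo G N \<phi>) = section_entropy G \<phi> (carrier G) N"
proof -
  interpret Q: group_endo "G Mod N" "induced_endo G N \<phi>" by (rule factor_endo[OF N])
  have "section_entropy G \<phi> (carrier G) N
      = section_entropy (G Mod N) (induced_endo G N \<phi>) ((\<lambda>x. N #> x) ` carrier G) {N}"
    using N normal_imp_subgroup pow_image_closed[of "carrier G" 1] subgroup_self
    by (intro section_entropy_factor) auto
  then show ?thesis
    using Q.algebraic_entropy_eq_section_entropy by (simp add: carrier_FactGroup)
qed

text \<open>Both sections have the same image in \<open>G Mod N\<close>, namely that of
  \<open>K\<close>, since factors from \<open>N\<close> disappear there.\<close>

lemma section_entropy_second_iso:
  assumes N: "N \<lhd> G" "\<phi> ` N \<subseteq> N" and K: "subgroup K G" "\<phi> ` K \<subseteq> K"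
  shows "section_entropy G \<phi> (N <#> K) N = section_entropy G \<phi> K (K \<inter> N)"
proof -
  have Ns: "subgroup N G" using N(1) normal_imp_subgroup by blast
  have sub: "N \<subseteq> carrier G" "K \<subseteq> carrier G" using Ns K(1) subgroup.subset by blast+
  have NK: "subgroup (N <#> K) G" using mult_norm_subgroup[OF N(1) K(1)] .
  have inv: "\<phi> ` (N <#> K) \<subseteq> N <#> K"
    using hom_image_set_mult[OF endo sub] mono_set_mult[OF N(2) K(2), of G] by simp
  have img: "(\<lambda>x. N #> x) ` (N <#> K) = (\<lambda>x. N #> x) ` K"
  proof
    show "(\<lambda>x. N #> x) ` K \<subseteq> (\<lambda>x. N #> x) ` (N <#> K)"
      by (rule image_mono) (rule subset_set_mult_left[OF sub(2) subgroup.one_closed[OF Ns]])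
    show "(\<lambda>x. N #> x) ` (N <#> K) \<subseteq> (\<lambda>x. N #> x) ` K"
    proof clarify
      fix x assume "x \<in> N <#> K"
      then obtain n k where nk: "n \<in> N" "k \<in> K" "x = n \<otimes> k" by (auto elim: set_multE)
      then have "N #> x = N #> k"
        using coset_mult_assoc[OF sub(1), of n k] coset_join2[of n, OF _ Ns] sub by auto
      then show "N #> x \<in> (\<lambda>x. N #> x) ` K" using nk(2) by blast
    qed
  qed
  have "section_entropy G \<phi> (N <#> K) N
      = section_entropy (G Mod N) (induced_endo G N \<phi>) ((\<lambda>x. N #> x) ` (N <#> K)) {N}"
    by (rule section_entropy_factor[OF N NK inv Ns]) simp
  moreover have "section_entropy G \<phi> K (K \<inter> N)
      = section_entropy (G Mod N) (induced_endo G N \<phi>) ((\<lambda>x. N #> x) ` K) {N}"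
    by (rule section_entropy_factor[OF N K subgroups_Inter_pair[OF K(1) Ns]]) simp
  ultimately show ?thesis by (simp add: img)
qed

text \<open>The core case is applied inside K/N with M/N as the central subgroup. The two commutator
  hypotheses say that M/N is central in K/N and that K/M is abelian; the three entropies are then
  transferred back to \<open>G\<close>.\<close>

theorem section_entropy_tower:
  assumes N: "N \<lhd> G" "\<phi> ` N \<subseteq> N" and M: "subgroup M G" "\<phi> ` M \<subseteq> M"
    and K: "subgroup K G" "\<phi> ` K \<subseteq> K" and le: "N \<subseteq> M" "M \<subseteq> K"
    and central: "\<And>x y. \<lbrakk>x \<in> K; y \<in> M\<rbrakk> \<Longrightarrow> x \<otimes> y \<otimes> inv x \<otimes> inv y \<in> N"
    and abelian: "\<And>x y. \<lbrakk>x \<in> K; y \<in> K\<rbrakk> \<Longrightarrow> x \<otimes> y \<otimes> inv x \<otimes> inv y \<in> M"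
    and tor: "\<And>x. x \<in> K \<Longrightarrow> \<exists>n::nat. n > 0 \<and> x [^] n = \<one>"
  shows "section_entropy G \<phi> K N = section_entropy G \<phi> M N + section_entropy G \<phi> K M"
proof -
  let ?p = "\<lambda>x. N #> x" and ?\<psi> = "induced_endo G N \<phi>"
  let ?Q = "(G Mod N)\<lparr>carrier := ?p ` K\<rparr>"
  have Ns: "subgroup N G" using N(1) normal_imp_subgroup by blast
  have Kc: "K \<subseteq> carrier G" using K(1) subgroup.subset by blast
  interpret F: group_endo "G Mod N" ?\<psi> by (rule factor_endo[OF N])
  interpret p: group_hom G "G Mod N" ?p
    using normal.r_coset_hom_Mod[OF N(1)] by (simp add: group_hom_def group_hom_axioms_def is_group F.is_group)
  have psi: "?\<psi> (?p x) = ?p (\<phi> x)" if "x \<in> K" for x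
    using induced_endo_rcos[OF N(1) endo N(2)] that Kc by blast
  have pK: "subgroup (?p ` K) (G Mod N)" and pM: "subgroup (?p ` M) (G Mod N)"
    using p.subgroup_img_is_subgroup K(1) M(1) by blast+
  have inv: "?\<psi> ` ?p ` K \<subseteq> ?p ` K" "?\<psi> ` ?p ` M \<subseteq> ?p ` M"
    using psi K(2) M(2) le(2) by (auto simp: image_subset_iff)
  interpret Q0: group_endo ?Q "restrict ?\<psi> (?p ` K)" by (rule F.restrict_endo[OF pK inv(1)])
  have mult: "?p x <#> ?p y = ?p (x \<otimes> y)" if "x \<in> K" "y \<in> K" for x y
    using normal.rcos_sum[OF N(1)] that Kc by blast
  have invQ: "inv\<^bsub>?Q\<^esub> ?p x = ?p (inv x)" if "x \<in> K" for x
    using F.m_inv_consistent[OF pK, of "?p x"] p.hom_inv[of x] that Kc by auto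
  have coset: "?p x = ?p y \<longleftrightarrow> x \<otimes> inv y \<in> N" if "x \<in> K" "y \<in> K" for x y
    using rcos_eq_iff[OF Ns] that Kc by blast
  interpret Q: central_endo ?Q "restrict ?\<psi> (?p ` K)" "?p ` M"
  proof (intro central_endo.intro central_endo_axioms.intro Q0.group_endo_axioms)
    show "subgroup (?p ` M) ?Q"
      using F.subgroup_incl[OF pM pK] le(2) by blast
    show "restrict ?\<psi> (?p ` K) ` ?p ` M \<subseteq> ?p ` M"
      using inv(2) le(2) by (auto simp: image_subset_iff)
  next
    fix a x assume "a \<in> ?p ` M" "x \<in> carrier ?Q"
    then obtain b y where yb: "b \<in> M" "a = ?p b" "y \<in> K" "x = ?p y" by auto
    have K': "b \<in> K" "y \<otimes> b \<in> K" "b \<otimes> y \<in> K"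
      using yb le(2) subgroup.m_closed[OF K(1)] by blast+
    \<comment> \<open>The two products differ by a commutator in \<open>N\<close>, so their cosets
      agree.\<close>
    have "(y \<otimes> b) \<otimes> inv (b \<otimes> y) = y \<otimes> b \<otimes> inv y \<otimes> inv b"
      using K'(1) yb(3) Kc by (simp add: subset_iff inv_mult_group m_assoc)
    then have "?p (y \<otimes> b) = ?p (b \<otimes> y)" using coset[OF K'(2,3)] central[OF yb(3,1)] by simp
    then show "a \<otimes>\<^bsub>?Q\<^esub> x = x \<otimes>\<^bsub>?Q\<^esub> a" using yb K'(1) by (simp add: mult)
  next
    fix x y assume "x \<in> carrier ?Q" "y \<in> carrier ?Q"
    then obtain u v where uv: "u \<in> K" "v \<in> K" "x = ?p u" "y = ?p v" by auto
    have K': "u \<otimes> v \<in> K" "inv u \<in> K" "inv v \<in> K" "u \<otimes> v \<otimes> inv u \<in> K"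
      using uv K(1) by (simp_all add: subgroup.m_closed subgroup.m_inv_closed)
    show "x \<otimes>\<^bsub>?Q\<^esub> y \<otimes>\<^bsub>?Q\<^esub> inv\<^bsub>?Q\<^esub> x \<otimes>\<^bsub>?Q\<^esub> inv\<^bsub>?Q\<^esub> y \<in> ?p ` M"
      using abelian[OF uv(1,2)] uv K' by (simp add: invQ mult)
  qed
  have torQ: "\<exists>n::nat. n > 0 \<and> x [^]\<^bsub>?Q\<^esub> n = \<one>\<^bsub>?Q\<^esub>" if "x \<in> carrier ?Q" for x
  proof -
    obtain y where y: "y \<in> K" "x = ?p y" using \<open>x \<in> carrier ?Q\<close> by auto
    obtain n :: nat where n: "n > 0" "y [^] n = \<one>" using tor[OF y(1)] by blast
    have "x [^]\<^bsub>?Q\<^esub> n = ?p (y [^] n)"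
      using normal.FactGroup_pow[OF N(1), of y n] y Kc by (auto simp: F.nat_pow_consistent[symmetric])
    also have "\<dots> = \<one>\<^bsub>?Q\<^esub>" using n(2) p.hom_one by simp
    finally show ?thesis using n(1) by blast
  qed
  have homK: "?p \<in> hom (G\<lparr>carrier := K\<rparr>) ?Q"
    using mult by (auto simp: hom_def)
  then have homM: "?p \<in> hom (G\<lparr>carrier := M\<rparr>) ?Q"
    using le(2) by (auto simp: hom_def)
  have comm: "restrict ?\<psi> (?p ` K) (?p x) = ?p (\<phi> x)" if "x \<in> K" for x
    using psi[OF that] that by simp
  have one: "?p x \<in> {\<one>\<^bsub>?Q\<^esub>} \<longleftrightarrow> x \<in> N" if "x \<in> K" for x
    using rcos_eq_self_iff[OF Ns] that Kc by auto
  \<comment> \<open>As \<open>N\<close> is contained in \<open>M\<close>, a coset of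
    \<open>N\<close> with a representative in \<open>M\<close> lies entirely in
    \<open>M\<close>.\<close>
  have mem: "?p x \<in> ?p ` M \<longleftrightarrow> x \<in> M" if "x \<in> K" for x
  proof
    assume "?p x \<in> ?p ` M"
    then obtain y where y: "y \<in> M" "?p x = ?p y" by blast
    then have "x \<otimes> inv y \<in> M" using coset[of x y] that le by blast
    then have "x \<otimes> inv y \<otimes> y \<in> M" using y(1) M(1) by (simp add: subgroup.m_closed)
    moreover have "y \<in> carrier G" "x \<in> carrier G" using y(1) that le Kc by blast+
    ultimately show "x \<in> M" by (simp add: m_assoc)
  qed simp
  have "section_entropy G \<phi> K N
      = section_entropy ?Q (restrict ?\<psi> (?p ` K)) (carrier ?Q) {\<one>\<^bsub>?Q\<^esub>}"
    by (rule section_entropy_transfer[OF group_endo_axioms Q0.group_endo_axioms K Ns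
          Q0.triv_subgroup homK _ comm one]) simp_all
  moreover have "section_entropy G \<phi> M N
      = section_entropy ?Q (restrict ?\<psi> (?p ` K)) (?p ` M) {\<one>\<^bsub>?Q\<^esub>}"
    using le(2) comm one
    by (intro section_entropy_transfer[OF group_endo_axioms Q0.group_endo_axioms M Ns
          Q0.triv_subgroup homM]) blast+
  moreover have "section_entropy G \<phi> K M
      = section_entropy ?Q (restrict ?\<psi> (?p ` K)) (carrier ?Q) (?p ` M)"
    by (rule section_entropy_transfer[OF group_endo_axioms Q0.group_endo_axioms K M(1)
          Q.A_subgroup homK _ comm mem]) simp_all
  ultimately show ?thesis using Q.section_entropy_add torQ by simp
qed

end

section \<open>Combination of five sections in class two\<close>

theorem theorem4p6:
  fixes G :: "('a, 'b) monoid_scheme" and \<phi> :: "'a \<Rightarrow> 'a" and H :: "'a set"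
  assumes "group G"
    and "nilpotent_of_class G 2"
    and "torsion_group G"
    and "\<phi> \<in> hom G G"
    and "H \<lhd> G"
    and "\<phi> ` H \<subseteq> H"
  shows "algebraic_entropy G \<phi> =
           algebraic_entropy (G\<lparr>carrier := H\<rparr>) (restrict \<phi> H)
         + algebraic_entropy (G Mod H) (induced_endo G H \<phi>)"
proof -
  interpret group_endo G \<phi> using assms(1,4) by (simp add: group_endo_def group_endo_axioms_def)
  let ?c = "\<lambda>x y. x \<otimes>\<^bsub>G\<^esub> y \<otimes>\<^bsub>G\<^esub> inv\<^bsub>G\<^esub> x \<otimes>\<^bsub>G\<^esub> inv\<^bsub>G\<^esub> y"
  let ?h = "section_entropy G \<phi>"
  define A where "A = derived G (carrier G)"
  \<comment> \<open>The series is indexed from 0, so its term 1 is the commutator subgroup, and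
    class 2 makes term 2 trivial.\<close>
  have A_lcs: "A = lower_central_series G 1"
  proof -
    have "derived_set G (carrier G) = {?c a b | a b. a \<in> carrier G \<and> b \<in> carrier G}" by auto
    then show ?thesis by (simp add: A_def derived_def commutator_subgroup_def)
  qed
  have A: "A \<lhd> G" unfolding A_def by (rule derived_self_is_normal)
  then have As: "subgroup A G" by (rule normal_imp_subgroup)
  have Ac: "A \<subseteq> carrier G" using As subgroup.subset by blast
  have comm: "?c x y \<in> A" if "x \<in> carrier G" "y \<in> carrier G" for x y
    unfolding A_def derived_def using that by (auto intro!: generate.incl)
  have central: "?c a x = \<one>\<^bsub>G\<^esub>" if "a \<in> A" "x \<in> carrier G" for a x
  proof -
    have "lower_central_series G (Suc 1) = {\<one>\<^bsub>G\<^esub>}"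
      using assms(2) by (simp add: nilpotent_of_class_def numeral_2_eq_2)
    then have "generate G {?c a b | a b. a \<in> A \<and> b \<in> carrier G} = {\<one>\<^bsub>G\<^esub>}"
      by (simp only: lower_central_series.simps commutator_subgroup_def A_lcs)
    moreover have "?c a x \<in> generate G {?c a b | a b. a \<in> A \<and> b \<in> carrier G}"
      using that by (auto intro!: generate.incl)
    ultimately show ?thesis by blast
  qed
  have central': "?c x a = \<one>\<^bsub>G\<^esub>" if "a \<in> A" "x \<in> carrier G" for a x
  proof -
    have "?c x a = inv\<^bsub>G\<^esub> (?c a x)" using that Ac by (simp add: subset_iff inv_mult_group m_assoc)
    then show ?thesis using central[OF that] by simp
  qed
  have A_inv: "\<phi> ` A \<subseteq> A"
  proof -
    have "group_hom G G \<phi>" using endo by (simp add: group_hom_def group_hom_axioms_def)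
    then have "\<phi> ` A = generate G (\<phi> ` derived_set G (carrier G))"
      unfolding A_def derived_def by (rule group_hom.generate_img[OF _ derived_set_in_carrier[OF subset_refl], symmetric])
    also have "\<phi> ` derived_set G (carrier G) \<subseteq> derived_set G (carrier G)"
    proof clarsimp
      fix x y assume "x \<in> carrier G" "y \<in> carrier G"
      then have "\<phi> (?c x y) = ?c (\<phi> x) (\<phi> y)" "\<phi> x \<in> carrier G" "\<phi> y \<in> carrier G"
        using pow_mult[of _ _ 1] pow_inv[of _ 1] pow_closed[of _ 1] by simp_all
      then show "\<exists>u\<in>carrier G. \<exists>v\<in>carrier G. \<phi> (?c x y) = ?c u v" by blast
    qed
    then have "generate G (\<phi> ` derived_set G (carrier G)) \<subseteq> A"
      unfolding A_def derived_def by (rule mono_generate)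
    finally show ?thesis .
  qed
  have tor: "\<exists>n::nat. n > 0 \<and> x [^]\<^bsub>G\<^esub> n = \<one>\<^bsub>G\<^esub>" if "x \<in> carrier G" for x
    using assms(3) that by (simp add: torsion_group_def)
  have H: "H \<lhd> G" "\<phi> ` H \<subseteq> H" "subgroup H G" using assms normal_imp_subgroup by blast+
  have Hc: "H \<subseteq> carrier G" using H(3) subgroup.subset by blast
  have one: "{\<one>\<^bsub>G\<^esub>} \<lhd> G" "\<phi> ` {\<one>\<^bsub>G\<^esub>} \<subseteq> {\<one>\<^bsub>G\<^esub>}" using one_is_normal pow_one[of 1] by auto
  have oneH: "\<one>\<^bsub>G\<^esub> \<in> H" and oneA: "\<one>\<^bsub>G\<^esub> \<in> A" using H(3) As by (auto intro: subgroup.one_closed)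
  have Gs: "subgroup (carrier G) G" "\<phi> ` carrier G \<subseteq> carrier G"
    using subgroup_self pow_image_closed[of "carrier G" 1] by auto
  have commH: "?c x h \<in> H" if "x \<in> carrier G" "h \<in> H" for x h
  proof -
    have "x \<otimes>\<^bsub>G\<^esub> h \<otimes>\<^bsub>G\<^esub> inv\<^bsub>G\<^esub> x \<in> H" using normal.inv_op_closed2[OF H(1) that] .
    then show ?thesis using that(2) H(3) by (simp add: subgroup.m_closed subgroup.m_inv_closed)
  qed
  define P where "P = H <#>\<^bsub>G\<^esub> A"
  \<comment> \<open>\<open>section_entropy_second_iso\<close> puts the normal factor first, and both
    \<open>H\<close> and \<open>A\<close> play that part below.\<close>
  have P_AH: "P = A <#>\<^bsub>G\<^esub> H" unfolding P_def by (rule commut_normal[OF H(3) A])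
  have P: "subgroup P G" unfolding P_def by (rule mult_norm_subgroup[OF H(1) As])
  have P_inv: "\<phi> ` P \<subseteq> P"
    unfolding P_def using hom_image_set_mult[OF endo Hc Ac] mono_set_mult[OF H(2) A_inv, of G] by simp
  have HP: "H \<subseteq> P" unfolding P_def by (rule subset_set_mult_right[OF Hc oneA])
  have AP: "A \<subseteq> P" unfolding P_def by (rule subset_set_mult_left[OF Ac oneH])
  have Pc: "P \<subseteq> carrier G" using P subgroup.subset by blast
  have HA: "subgroup (H \<inter> A) G" "\<phi> ` (H \<inter> A) \<subseteq> H \<inter> A" "H \<inter> A \<lhd> G"
    using subgroups_Inter_pair[OF H(3) As] H(2) A_inv normal_subgroup_intersect[OF H(1) A] by auto
  \<comment> \<open>Centrality of the image of \<open>P\<close> in G/H: for y = h a the central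
    factor \<open>a\<close> cancels, and the commutator of \<open>x\<close> and \<open>h\<close>
    lies in the normal subgroup \<open>H\<close>.\<close>
  have commP: "?c x y \<in> H" if "x \<in> carrier G" "y \<in> P" for x y
  proof -
    obtain h a where ha: "h \<in> H" "a \<in> A" "y = h \<otimes>\<^bsub>G\<^esub> a"
      using \<open>y \<in> P\<close> unfolding P_def by (auto elim: set_multE)
    have c: "h \<in> carrier G" "a \<in> carrier G" using ha Hc Ac by blast+
    have "a \<otimes>\<^bsub>G\<^esub> inv\<^bsub>G\<^esub> x = inv\<^bsub>G\<^esub> x \<otimes>\<^bsub>G\<^esub> a"
      using central[OF ha(2), of "inv\<^bsub>G\<^esub> x"] that(1) c
      by (metis inv_closed inv_equality inv_inv inv_mult_group m_assoc m_closed)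
    then have "?c x y = ?c x h"
      using that(1) c by (simp add: ha(3) inv_mult_group m_assoc)
        (metis inv_closed m_assoc m_closed r_inv l_one)
    then show ?thesis using commH[OF that(1) ha(1)] by simp
  qed
  \<comment> \<open>Each tower over \<open>N\<close>, \<open>M\<close>, \<open>K\<close> needs
    [K, M] inside \<open>N\<close> and [K, K] inside \<open>M\<close>. In 1, 3 and 4 the first holds
    because \<open>A\<close> is central, in 2 because \<open>A\<close> contains all commutators, and
    in 5 by \<open>commP\<close>.\<close>
  have 1: "?h (carrier G) {\<one>\<^bsub>G\<^esub>} = ?h A {\<one>\<^bsub>G\<^esub>} + ?h (carrier G) A"
    by (rule section_entropy_tower[OF one As A_inv Gs]) (use oneA Ac central' comm tor in auto)
  have 2: "?h (carrier G) A = ?h P A + ?h (carrier G) P"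
    by (rule section_entropy_tower[OF A A_inv P P_inv Gs]) (use AP Pc comm tor in auto)
  have 3: "?h A {\<one>\<^bsub>G\<^esub>} = ?h (H \<inter> A) {\<one>\<^bsub>G\<^esub>} + ?h A (H \<inter> A)"
    by (rule section_entropy_tower[OF one HA(1,2) As A_inv])
      (use oneA oneH Ac central tor subgroup.one_closed[OF HA(1)] in auto)
  have 4: "?h H {\<one>\<^bsub>G\<^esub>} = ?h (H \<inter> A) {\<one>\<^bsub>G\<^esub>} + ?h H (H \<inter> A)"
    by (rule section_entropy_tower[OF one HA(1,2) H(3,2)])
      (use oneA oneH Hc central' commH comm[OF subsetD[OF Hc] subsetD[OF Hc]] tor in auto)
  have 5: "?h (carrier G) H = ?h P H + ?h (carrier G) P"
    by (rule section_entropy_tower[OF H(1,2) P P_inv Gs]) (use HP Pc commP AP comm tor in auto)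
  have 6: "?h P A = ?h H (H \<inter> A)"
    unfolding P_AH by (rule section_entropy_second_iso[OF A A_inv H(3,2)])
  have 7: "?h P H = ?h A (H \<inter> A)"
    using section_entropy_second_iso[OF H(1,2) As A_inv] by (simp add: P_def Int_commute)
  \<comment> \<open>Both sides unfold to the same four summands, so nothing is cancelled and
    infinite values cause no trouble.\<close>
  have "?h (carrier G) {\<one>\<^bsub>G\<^esub>} = ?h H {\<one>\<^bsub>G\<^esub>} + ?h (carrier G) H"
    unfolding 1 2 3 4 5 6 7 by (simp only: ac_simps)
  then show ?thesis
    by (simp add: algebraic_entropy_eq_section_entropy algebraic_entropy_restrict[OF H(3,2)]
        algebraic_entropy_factor[OF H(1,2)])
qed

end
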